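(* Let $T \in \mathbb{C}^a\otimes\mathbb{C}^b\otimes\mathbb{C}^c$ be a tensor. The Borel polytope algorithm (described in the context), run on input $T$, outputs a defining set of inequalities for the Borel polytope $\Delta_{\mathrm B}(T)$. That is, if $\mathcal H_T$ denotes the set of all $h\in\mathcal H$ for which the reduced Gröbner basis of the ideal generated by $F^T(h)$ over $\mathbb F$ is not equal to $\{1\}$, then $$\Delta_{\mathrm B}(T)=\bigcap_{h\in\mathcal H_T}H_h\ \cap\ \mathcal D .$$
   Context: Weights: $\Omega=\{(e_i\mid e_j\mid e_k)\}_{i,j,k}\subseteq\mathbb{R}^a\times\mathbb{R}^b\times\mathbb{R}^c\cong\mathbb{R}^{a+b+c}$, with $i\in[a],j\in[b],k\in[c]$. For a tensor $T=\sum T_{i,j,k}\,e_i\otimes e_j\otimes e_k$ and $\omega=(e_i\mid e_j\mid e_k)$ write $T_\omega=T_{i,j,k}$, and $\operatorname{supp}T=\{\omega\in\Omega: T_\omega\ne0\}$. $\mathcal D\subseteq\mathbb{R}^{a+b+c}$ is the set of triples of real vectors each with non-increasing entries. $\mathrm{GL}_{\mathrm{low}}$ is the group of triples $(A,B,C)$ of invertible complex lower triangular matrices of sizes $a,b,c$. The Borel polytope of $T$ is $$\Delta_{\mathrm B}(T)=\bigcap_{(A,B,C)\in \mathrm{GL}_{\mathrm{low}}}\operatorname{conv}\operatorname{supp}\big((A\otimes B\otimes C)T\big)\ \cap\ \mathcal D .$$ Inequalities $h$ are identified with closed half-spaces $H_h\subseteq\mathbb{R}^{a+b+c}$; $\Omega_h:=\Omega\cap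 H_h$. A set of inequalities defines a polytope $P$ if $P$ is the intersection of the corresponding half-spaces. $\mathcal H$ is any fixed finite set of inequalities such that for every $S\subseteq\Omega$ some subset of $\mathcal H$ defines $\operatorname{conv}S$. $\mathbb F=\mathbb{Q}(\{T_\omega\mid\omega\in\Omega\})\subseteq\mathbb{C}$ is the field generated by the entries of $T$. Let $\mathcal A,\mathcal B,\mathcal C$ be lower triangular matrices of sizes $a,b,c$ with ones on the diagonal and independent variables $x_1,\dots,x_m$ as strictly lower triangular entries. For an inequality $h$, $F^T(h)=\{((\mathcal A\otimes\mathcal B\otimes\mathcal C)T)_\omega\mid\omega\in\Omega\setminus\Omega_h\}\subseteq\mathbb F[x_1,\dots,x_m]$. Reduced Gröbner bases are taken with respect to a fixed monomial order. Borel polytope algorithm: start with $\mathcal H_T=\varnothing$; for each $h\in\mathcal H$ compute the reduced Gröbner basis $G$ of $\langle F^T(h)\rangle$ over $\mathbb F$ and add $h$ to $\mathcal H_T$ if $G\neq\{1\}$; return $\mathcal H_T$ together with a set of inequalities defining $\mathcal D$. *)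

theory Defs
  imports
    "HOL-Analysis.Analysis"
    "HOL-Library.Poly_Mapping"
    "HOL-Algebra.Generated_Fields"
    "HOL-Algebra.Algebraic_Closure_Type"
begin

section \<open>Tensors and Borel polytopes\<close>

text \<open>The index sets $[a]$, $[b]$, $[c]$ are finite linearly ordered types \<open>'a\<close>, \<open>'b\<close>, \<open>'c\<close>;
  the order is needed for triangularity and for monotonicity of the entries.\<close>

type_synonym ('r, 'n) sqmatrix = "'r ^ 'n ^ 'n"

type_synonym ('r, 'a, 'b, 'c) tensor = "'r ^ 'c ^ 'b ^ 'a"

type_synonym ('a, 'b, 'c) weight_space = "(real ^ 'a) \<times> (real ^ 'b) \<times> (real ^ 'c)"

definition weight :: "'a \<Rightarrow> 'b \<Rightarrow> 'c \<Rightarrow> ('a::finite, 'b::finite, 'c::finite) weight_space" where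
  "weight i j k = (axis i 1, axis j 1, axis k 1)"

definition Omega :: "('a::finite, 'b::finite, 'c::finite) weight_space set" where
  "Omega = {weight i j k | i j k. True}"

definition supp :: "('r::zero, 'a::finite, 'b::finite, 'c::finite) tensor \<Rightarrow> ('a, 'b, 'c) weight_space set" where
  "supp T = {weight i j k | i j k. T $ i $ j $ k \<noteq> 0}"

definition tensor_act ::
  "('r, 'a) sqmatrix \<Rightarrow> ('r, 'b) sqmatrix \<Rightarrow> ('r, 'c) sqmatrix \<Rightarrow>
    ('r::comm_semiring_1, 'a::finite, 'b::finite, 'c::finite) tensor \<Rightarrow> ('r, 'a, 'b, 'c) tensor" where
  "tensor_act A B C T = (\<chi> i j k. \<Sum>i'\<in>UNIV. \<Sum>j'\<in>UNIV. \<Sum>k'\<in>UNIV.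
     A $ i $ i' * B $ j $ j' * C $ k $ k' * T $ i' $ j' $ k')"

definition lower_triangular :: "('r::zero, 'n::{finite,linorder}) sqmatrix \<Rightarrow> bool" where
  "lower_triangular A \<longleftrightarrow> (\<forall>i j. i < j \<longrightarrow> A $ i $ j = 0)"

definition GL_low ::
  "((complex, 'a::{finite,linorder}) sqmatrix \<times> (complex, 'b::{finite,linorder}) sqmatrix \<times>
     (complex, 'c::{finite,linorder}) sqmatrix) set" where
  "GL_low = {(A, B, C). invertible A \<and> lower_triangular A \<and> invertible B \<and> lower_triangular B \<and>
     invertible C \<and> lower_triangular C}"

definition nonincreasing :: "real ^ ('n::{finite,linorder}) \<Rightarrow> bool" where
  "nonincreasing x \<longleftrightarrow> (\<forall>i j. i \<le> j \<longrightarrow> x $ j \<le> x $ i)"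

definition dominant ::
  "('a::{finite,linorder}, 'b::{finite,linorder}, 'c::{finite,linorder}) weight_space set" where
  "dominant = {(x, y, z). nonincreasing x \<and> nonincreasing y \<and> nonincreasing z}"

definition borel_polytope ::
  "(complex, 'a::{finite,linorder}, 'b::{finite,linorder}, 'c::{finite,linorder}) tensor \<Rightarrow>
    ('a, 'b, 'c) weight_space set" where
  "borel_polytope T =
     (\<Inter>(A, B, C)\<in>GL_low. convex hull (supp (tensor_act A B C T))) \<inter> dominant"

section \<open>Inequalities\<close>

text \<open>The pair $(n, \beta)$ stands for the inequality $\langle n, x\rangle \le \beta$; it describes a
  half-space when $n \neq 0$.\<close>

type_synonym 'v inequality = "'v \<times> real"

definition halfspace :: "'v::real_inner inequality \<Rightarrow> 'v set" where
  "halfspace h = {x. fst h \<bullet> x \<le> snd h}"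

definition inequalities :: "'v::real_inner inequality set \<Rightarrow> bool" where
  "inequalities H \<longleftrightarrow> (\<forall>h\<in>H. fst h \<noteq> 0)"

definition defining_set :: "'v::real_inner inequality set \<Rightarrow> 'v set \<Rightarrow> bool" where
  "defining_set H P \<longleftrightarrow> P = (\<Inter>h\<in>H. halfspace h)"

definition Omega_in ::
  "('a, 'b, 'c) weight_space inequality \<Rightarrow> ('a::finite, 'b::finite, 'c::finite) weight_space set" where
  "Omega_in h = Omega \<inter> halfspace h"

section \<open>Polynomials and Groebner bases\<close>

type_synonym ('v, 'r) mpoly = "('v \<Rightarrow>\<^sub>0 nat) \<Rightarrow>\<^sub>0 'r"

definition const_poly :: "'r::zero \<Rightarrow> ('v, 'r) mpoly" where
  "const_poly c = Poly_Mapping.single 0 c"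

definition var_poly :: "'v \<Rightarrow> ('v, 'r::zero_neq_one) mpoly" where
  "var_poly v = Poly_Mapping.single (Poly_Mapping.single v 1) 1"

definition monomials :: "'v set \<Rightarrow> ('v \<Rightarrow>\<^sub>0 nat) set" where
  "monomials V = {s. Poly_Mapping.keys s \<subseteq> V}"

text \<open>The ring $K[V]$ for a subfield $K$ of the coefficient field, inside the polynomials over the whole
  field and in all variables of type \<open>'v\<close>.\<close>

definition mpoly_ring :: "'r::field set \<Rightarrow> 'v set \<Rightarrow> ('v, 'r) mpoly ring" where
  "mpoly_ring K V = ring_of_type_algebra
     \<lparr>carrier := {p. Poly_Mapping.keys p \<subseteq> monomials V \<and> (\<forall>s. Poly_Mapping.lookup p s \<in> K)}\<rparr>"

text \<open>\<open>(s, t) \<in> r\<close> means $s \le t$.\<close>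

definition monomial_order :: "'v set \<Rightarrow> ('v \<Rightarrow>\<^sub>0 nat) rel \<Rightarrow> bool" where
  "monomial_order V r \<longleftrightarrow> well_order_on (monomials V) r \<and>
     (\<forall>s t. \<forall>u\<in>monomials V. (s, t) \<in> r \<longrightarrow> (s + u, t + u) \<in> r)"

definition lead_monomial :: "('v \<Rightarrow>\<^sub>0 nat) rel \<Rightarrow> ('v, 'r::zero) mpoly \<Rightarrow> ('v \<Rightarrow>\<^sub>0 nat)" where
  "lead_monomial r p =
     (THE s. s \<in> Poly_Mapping.keys p \<and> (\<forall>t\<in>Poly_Mapping.keys p. (t, s) \<in> r))"

definition lead_coefficient :: "('v \<Rightarrow>\<^sub>0 nat) rel \<Rightarrow> ('v, 'r::zero) mpoly \<Rightarrow> 'r" where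
  "lead_coefficient r p = Poly_Mapping.lookup p (lead_monomial r p)"

definition lead_term :: "('v \<Rightarrow>\<^sub>0 nat) rel \<Rightarrow> ('v, 'r::zero) mpoly \<Rightarrow> ('v, 'r) mpoly" where
  "lead_term r p = Poly_Mapping.single (lead_monomial r p) (lead_coefficient r p)"

definition groebner_basis ::
  "'r::field set \<Rightarrow> 'v set \<Rightarrow> ('v \<Rightarrow>\<^sub>0 nat) rel \<Rightarrow> ('v, 'r) mpoly set \<Rightarrow> ('v, 'r) mpoly set \<Rightarrow> bool" where
  "groebner_basis K V r I G \<longleftrightarrow> finite G \<and> G \<subseteq> I \<and>
     genideal (mpoly_ring K V) (lead_term r ` (G - {0})) =
     genideal (mpoly_ring K V) (lead_term r ` (I - {0}))"

definition is_reduced_groebner_basis ::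
  "'r::field set \<Rightarrow> 'v set \<Rightarrow> ('v \<Rightarrow>\<^sub>0 nat) rel \<Rightarrow> ('v, 'r) mpoly set \<Rightarrow> ('v, 'r) mpoly set \<Rightarrow> bool" where
  "is_reduced_groebner_basis K V r I G \<longleftrightarrow> groebner_basis K V r I G \<and>
     (\<forall>p\<in>G. lead_coefficient r p = 1 \<and>
        (\<forall>s\<in>Poly_Mapping.keys p.
           Poly_Mapping.single s 1 \<notin> genideal (mpoly_ring K V) (lead_term r ` (G - {p}))))"

definition reduced_groebner_basis ::
  "'r::field set \<Rightarrow> 'v set \<Rightarrow> ('v \<Rightarrow>\<^sub>0 nat) rel \<Rightarrow> ('v, 'r) mpoly set \<Rightarrow> ('v, 'r) mpoly set" where
  "reduced_groebner_basis K V r I = (THE G. is_reduced_groebner_basis K V r I G)"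

section \<open>The Borel polytope algorithm\<close>

definition entry_field :: "(complex, 'a::finite, 'b::finite, 'c::finite) tensor \<Rightarrow> complex set" where
  "entry_field T = generate_field ring_of_type_algebra {T $ i $ j $ k | i j k. True}"

text \<open>The variables $x_1, \dots, x_m$ are named by the matrix and the position they occupy; only the
  strictly lower triangular positions, collected in \<open>low_vars\<close>, are used.\<close>

datatype ('a, 'b, 'c) low_var = XA 'a 'a | XB 'b 'b | XC 'c 'c

definition low_vars :: "('a::linorder, 'b::linorder, 'c::linorder) low_var set" where
  "low_vars = {XA i j | i j. j < i} \<union> {XB i j | i j. j < i} \<union> {XC i j | i j. j < i}"

definition generic_unitriangular ::
  "('n \<Rightarrow> 'n \<Rightarrow> 'v) \<Rightarrow> (('v, complex) mpoly, 'n::{finite,linorder}) sqmatrix" where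
  "generic_unitriangular x =
     (\<chi> i j. if j < i then var_poly (x i j) else if i = j then 1 else 0)"

definition generic_tensor ::
  "(complex, 'a::{finite,linorder}, 'b::{finite,linorder}, 'c::{finite,linorder}) tensor \<Rightarrow>
    ((('a, 'b, 'c) low_var, complex) mpoly, 'a, 'b, 'c) tensor" where
  "generic_tensor T =
     tensor_act (generic_unitriangular XA) (generic_unitriangular XB) (generic_unitriangular XC)
       (\<chi> i j k. const_poly (T $ i $ j $ k))"

definition F_polys ::
  "(complex, 'a::{finite,linorder}, 'b::{finite,linorder}, 'c::{finite,linorder}) tensor \<Rightarrow>
    ('a, 'b, 'c) weight_space inequality \<Rightarrow> (('a, 'b, 'c) low_var, complex) mpoly set" where
  "F_polys T h = {generic_tensor T $ i $ j $ k | i j k. weight i j k \<in> Omega - Omega_in h}"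

definition F_ideal ::
  "(complex, 'a::{finite,linorder}, 'b::{finite,linorder}, 'c::{finite,linorder}) tensor \<Rightarrow>
    ('a, 'b, 'c) weight_space inequality \<Rightarrow> (('a, 'b, 'c) low_var, complex) mpoly set" where
  "F_ideal T h = genideal (mpoly_ring (entry_field T) low_vars) (F_polys T h)"

definition selected_inequalities ::
  "(('a, 'b, 'c) low_var \<Rightarrow>\<^sub>0 nat) rel \<Rightarrow> ('a, 'b, 'c) weight_space inequality set \<Rightarrow>
    (complex, 'a::{finite,linorder}, 'b::{finite,linorder}, 'c::{finite,linorder}) tensor \<Rightarrow>
    ('a, 'b, 'c) weight_space inequality set" where
  "selected_inequalities r H T =
     {h \<in> H. reduced_groebner_basis (entry_field T) low_vars r (F_ideal T h) \<noteq> {1}}"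

definition borel_algorithm ::
  "(('a, 'b, 'c) low_var \<Rightarrow>\<^sub>0 nat) rel \<Rightarrow> ('a, 'b, 'c) weight_space inequality set \<Rightarrow>
    ('a, 'b, 'c) weight_space inequality set \<Rightarrow>
    (complex, 'a::{finite,linorder}, 'b::{finite,linorder}, 'c::{finite,linorder}) tensor \<Rightarrow>
    ('a, 'b, 'c) weight_space inequality set" where
  "borel_algorithm r H HD T = selected_inequalities r H T \<union> HD"

end

theory Submission
  imports Defs
begin

text \<open>An inequality \<open>h\<close> is selected exactly when \<open>F\<^sup>T(h)\<close> generates a proper ideal over the field of
  entries, because reduced Groebner bases exist and are unique and the one of the unit ideal is \<open>{1}\<close>.
  By the Nullstellensatz this means that the polynomials in \<open>F\<^sup>T(h)\<close> have a common complex zero, that is, some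
  triple of unitriangular matrices maps \<open>T\<close> to a tensor supported in the half-space of \<open>h\<close>.
  Every invertible lower triangular matrix is a diagonal matrix times a unitriangular one, and diagonal
  matrices do not change supports, so the selected inequalities are those elements of \<open>H\<close> that hold on
  the support of some tensor in the Borel orbit of \<open>T\<close>.\<close>

section \<open>Polynomials\<close>

subsection \<open>Induction principles\<close>

text \<open>The field \<open>entry_field T\<close> is in general not algebraically closed, while the
  matrices sought are complex. Hence the Nullstellensatz is proved over the complex numbers, where
  having uncountably many scalars against countably many monomials replaces dimension theory, and is
  then carried down to a subfield \<open>K\<close>: a \<open>K\<close>-linear retraction onto
  \<open>K\<close> shows that a proper ideal of \<open>K[V]\<close> stays inside a proper ideal
  after extension of scalars. \<open>reduced_groebner_basis\<close> is a definite description, so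
  its value is known only after existence and uniqueness; both are settled on sets of exponents,
  with Dickson's lemma for finiteness. The orbit is infinite and \<open>H\<close> does not depend on
  \<open>T\<close>. This causes no loss because \<open>H\<close> can define the hull of every subset
  of \<open>Omega\<close>: any hull arising from the orbit is cut out by members of
  \<open>H\<close>, and each of them is selected on account of the very tensor whose hull it
  bounds.\<close>

lemma poly_mapping_update_eq:
  assumes "k \<notin> Poly_Mapping.keys p"
  shows "Poly_Mapping.update k c p = p + Poly_Mapping.single k c"
  using assms
  by (intro poly_mapping_eqI) (auto simp: lookup_update lookup_add lookup_single in_keys_iff when_def)

lemma poly_mapping_single_induct [case_names zero single add]:
  fixes p :: "'k \<Rightarrow>\<^sub>0 'r::comm_monoid_add"
  assumes "P 0" and "\<And>k c. P (Poly_Mapping.single k c)"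
    and "\<And>p q. P p \<Longrightarrow> P q \<Longrightarrow> P (p + q)"
  shows "P p"
  by (induction p rule: update_induct) (use assms in \<open>auto simp: poly_mapping_update_eq\<close>)

lemma poly_mapping_sum_single:
  fixes p :: "'k \<Rightarrow>\<^sub>0 'r::comm_monoid_add"
  shows "p = (\<Sum>k\<in>Poly_Mapping.keys p. Poly_Mapping.single k (Poly_Mapping.lookup p k))"
  by (rule poly_mapping_eqI)
    (auto simp: lookup_sum lookup_single in_keys_iff when_def if_distrib sum.delta cong: if_cong)

lemma var_poly_power:
  "var_poly v ^ n = Poly_Mapping.single (Poly_Mapping.single v n) (1::'r::comm_ring_1)"
  by (induction n) (auto simp: var_poly_def mult_single single_add[symmetric])

text \<open>Constants and variables generate the ring; this is the form needed for reducing a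
  polynomial to its value modulo an ideal.\<close>

lemma mpoly_induct [case_names const var add mult]:
  fixes p :: "('v, 'r::comm_ring_1) mpoly"
  assumes const: "\<And>c. P (const_poly c)" and var: "\<And>v. P (var_poly v)"
    and add: "\<And>p q. P p \<Longrightarrow> P q \<Longrightarrow> P (p + q)"
    and mult: "\<And>p q. P p \<Longrightarrow> P q \<Longrightarrow> P (p * q)"
  shows "P p"
proof (induction p rule: poly_mapping_single_induct)
  case zero
  show ?case using const[of 0] by (simp add: const_poly_def)
next
  case (single s c)
  have "P (Poly_Mapping.single s 1)"
  proof (induction s rule: poly_mapping_single_induct)
    case zero
    show ?case using const[of 1] by (simp add: const_poly_def)
  next
    case (single v n)
    have "P (var_poly v ^ n)"
      by (induction n) (use const[of 1] var mult in \<open>auto simp: const_poly_def\<close>)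
    then show ?case by (simp add: var_poly_power)
  next
    case (add s t)
    then show ?case
      using mult[of "Poly_Mapping.single s 1" "Poly_Mapping.single t 1"] by (simp add: mult_single)
  qed
  then show ?case
    using mult[OF const[of c], of "Poly_Mapping.single s 1"] by (simp add: const_poly_def mult_single)
next
  case (add p q)
  then show ?case using assms(3) by blast
qed

subsection \<open>Evaluation\<close>

definition eval_monomial :: "('v \<Rightarrow> 'r::comm_ring_1) \<Rightarrow> ('v \<Rightarrow>\<^sub>0 nat) \<Rightarrow> 'r" where
  "eval_monomial x s = (\<Prod>v\<in>Poly_Mapping.keys s. x v ^ Poly_Mapping.lookup s v)"

definition eval_mpoly :: "('v \<Rightarrow> 'r::comm_ring_1) \<Rightarrow> ('v, 'r) mpoly \<Rightarrow> 'r" where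
  "eval_mpoly x p = (\<Sum>s\<in>Poly_Mapping.keys p. Poly_Mapping.lookup p s * eval_monomial x s)"

lemma eval_monomial_add: "eval_monomial x (s + t) = eval_monomial x s * eval_monomial x t"
proof -
  \<comment> \<open>All three products are taken over one index set; the extra variables have
    exponent 0 and contribute 1.\<close>
  let ?W = "Poly_Mapping.keys s \<union> Poly_Mapping.keys t"
  have *: "eval_monomial x u = (\<Prod>v\<in>?W. x v ^ Poly_Mapping.lookup u v)"
    if "Poly_Mapping.keys u \<subseteq> ?W" for u
    unfolding eval_monomial_def using that
    by (intro prod.mono_neutral_left) (auto simp: in_keys_iff)
  show ?thesis
    using keys_add[of s t] by (simp add: * lookup_add power_add prod.distrib)
qed

lemma eval_monomial_0 [simp]: "eval_monomial x 0 = 1"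
  by (simp add: eval_monomial_def)

lemma eval_mpoly_single: "eval_mpoly x (Poly_Mapping.single s c) = c * eval_monomial x s"
  by (simp add: eval_mpoly_def)

lemma eval_mpoly_0 [simp]: "eval_mpoly x 0 = 0"
  by (simp add: eval_mpoly_def)

lemma eval_mpoly_const [simp]: "eval_mpoly x (const_poly c) = c"
  by (simp add: const_poly_def eval_mpoly_single)

lemma eval_mpoly_1 [simp]: "eval_mpoly x 1 = 1"
  using eval_mpoly_const[of x 1] by (simp add: const_poly_def)

lemma eval_mpoly_var [simp]: "eval_mpoly x (var_poly v) = x v"
  by (simp add: var_poly_def eval_mpoly_single eval_monomial_def)

lemma eval_mpoly_add [simp]: "eval_mpoly x (p + q) = eval_mpoly x p + eval_mpoly x q"
  unfolding eval_mpoly_def by (rule setsum_keys_plus_distrib) (auto simp: algebra_simps)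

lemma eval_mpoly_sum [simp]: "eval_mpoly x (\<Sum>i\<in>A. f i) = (\<Sum>i\<in>A. eval_mpoly x (f i))"
  by (induction A rule: infinite_finite_induct) auto

lemma eval_mpoly_mult [simp]: "eval_mpoly x (p * q) = eval_mpoly x p * eval_mpoly x q"
proof (induction p rule: poly_mapping_single_induct)
  case (single s c)
  show ?case
    by (induction q rule: poly_mapping_single_induct)
      (auto simp: mult_single eval_mpoly_single eval_monomial_add distrib_left algebra_simps)
qed (auto simp: distrib_right)

subsection \<open>The ring of polynomials over a subfield\<close>

lemma monomials_0 [simp]: "0 \<in> monomials V"
  by (simp add: monomials_def)

text \<open>Natural exponents cannot cancel. The direction from left to right is what lets monomials
  outside \<open>V\<close> be discarded compatibly with multiplication.\<close>

lemma monomials_add_iff: "s + t \<in> monomials V \<longleftrightarrow> s \<in> monomials V \<and> t \<in> monomials V"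
  by (auto simp: monomials_def in_keys_iff lookup_add subset_iff)

locale mpolys_over_subfield =
  fixes K :: "'r::field set" and V :: "'v set"
  assumes subfield: "subfield K ring_of_type_algebra"
begin

abbreviation R where "R \<equiv> mpoly_ring K V"

lemma one_coeff [simp]: "1 \<in> K" and zero_coeff [simp]: "0 \<in> K"
  and add_coeff [intro]: "\<And>a b. a \<in> K \<Longrightarrow> b \<in> K \<Longrightarrow> a + b \<in> K"
  and mult_coeff [intro]: "\<And>a b. a \<in> K \<Longrightarrow> b \<in> K \<Longrightarrow> a * b \<in> K"
  using subringE[OF subfieldE(1)[OF subfield]] by (auto simp: ring_of_type_algebra_def)

lemma inverse_coeff [intro]:
  assumes "a \<in> K"
  shows "inverse a \<in> K"
proof (cases "a = 0")
  case False
  then have "a \<in> Units (ring_of_type_algebra\<lparr>carrier := K\<rparr>)"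
    using subfield.subfield_Units[OF subfield] assms by (simp add: ring_of_type_algebra_def)
  then obtain b where "b \<in> K" "b * a = 1"
    by (auto simp: Units_def ring_of_type_algebra_def)
  then show ?thesis
    by (metis inverse_unique mult.commute)
qed auto

lemma uminus_coeff [intro]:
  assumes "a \<in> K"
  shows "- a \<in> K"
proof -
  interpret A: field "ring_of_type_algebra :: 'r ring"
    by (rule field_from_type_algebra)
  have "(\<ominus>\<^bsub>ring_of_type_algebra\<^esub> a) + a = 0"
    using A.l_neg[of a] by (simp add: ring_of_type_algebra_def)
  then have "\<ominus>\<^bsub>ring_of_type_algebra\<^esub> a = - a"
    by (simp add: eq_neg_iff_add_eq_0)
  then show ?thesis
    using subringE(5)[OF subfieldE(1)[OF subfield] assms] by simp
qed

lemma diff_coeff [intro]: "a \<in> K \<Longrightarrow> b \<in> K \<Longrightarrow> a - b \<in> K"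
  using add_coeff[of a "- b"] by auto

lemma in_carrier_iff:
  "p \<in> carrier R \<longleftrightarrow> Poly_Mapping.keys p \<subseteq> monomials V \<and> (\<forall>s. Poly_Mapping.lookup p s \<in> K)"
  by (simp add: mpoly_ring_def)

lemma lookup_in [intro]: "p \<in> carrier R \<Longrightarrow> Poly_Mapping.lookup p s \<in> K"
  by (simp add: in_carrier_iff)

lemma keys_in [intro]: "p \<in> carrier R \<Longrightarrow> s \<in> Poly_Mapping.keys p \<Longrightarrow> s \<in> monomials V"
  by (auto simp: in_carrier_iff)

lemma ring_ops [simp]: "x \<otimes>\<^bsub>R\<^esub> y = x * y" "x \<oplus>\<^bsub>R\<^esub> y = x + y" "\<one>\<^bsub>R\<^esub> = 1" "\<zero>\<^bsub>R\<^esub> = 0"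
  by (simp_all add: mpoly_ring_def ring_of_type_algebra_def)

lemma zero_in [simp]: "0 \<in> carrier R"
  by (simp add: in_carrier_iff)

lemma single_in: "s \<in> monomials V \<Longrightarrow> c \<in> K \<Longrightarrow> Poly_Mapping.single s c \<in> carrier R"
  by (simp add: in_carrier_iff lookup_single when_def)

lemma one_in [simp]: "1 \<in> carrier R"
  using single_in[of 0 1] by simp

lemma add_in [intro]: "p \<in> carrier R \<Longrightarrow> q \<in> carrier R \<Longrightarrow> p + q \<in> carrier R"
  using keys_add[of p q] by (auto simp: in_carrier_iff lookup_add)

lemma uminus_in [intro]: "p \<in> carrier R \<Longrightarrow> - p \<in> carrier R"
  by (auto simp: in_carrier_iff in_keys_iff)

lemma diff_in [intro]: "p \<in> carrier R \<Longrightarrow> q \<in> carrier R \<Longrightarrow> p - q \<in> carrier R"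
  using add_in[of p "- q"] by auto

lemma sum_in: "(\<And>i. i \<in> A \<Longrightarrow> f i \<in> carrier R) \<Longrightarrow> (\<Sum>i\<in>A. f i) \<in> carrier R"
  by (induction A rule: infinite_finite_induct) auto

lemma mult_in [intro]:
  assumes "p \<in> carrier R" "q \<in> carrier R"
  shows "p * q \<in> carrier R"
proof -
  \<comment> \<open>The product is expanded into single terms, for which closure is
    immediate.\<close>
  have "(\<Sum>s\<in>Poly_Mapping.keys p. \<Sum>t\<in>Poly_Mapping.keys q.
      Poly_Mapping.single s (Poly_Mapping.lookup p s) * Poly_Mapping.single t (Poly_Mapping.lookup q t))
    \<in> carrier R"
    using assms by (intro sum_in) (auto simp: mult_single monomials_add_iff intro!: single_in)
  then show ?thesis
    by (simp flip: sum_product poly_mapping_sum_single)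
qed

lemma cring: "cring R"
proof (rule cringI)
  show "abelian_group R"
  proof (rule abelian_groupI)
    fix p assume "p \<in> carrier R"
    then show "\<exists>q\<in>carrier R. q \<oplus>\<^bsub>R\<^esub> p = \<zero>\<^bsub>R\<^esub>"
      by (intro bexI[of _ "- p"]) auto
  qed (auto simp: algebra_simps)
  show "comm_monoid R"
    by (rule comm_monoidI) (auto simp: algebra_simps)
qed (auto simp: algebra_simps)

text \<open>Closure under negation need not be listed, since it is multiplication by the constant
  -1.\<close>

lemma ideal_iff:
  "ideal I R \<longleftrightarrow> I \<subseteq> carrier R \<and> 0 \<in> I \<and> (\<forall>p\<in>I. \<forall>q\<in>I. p + q \<in> I) \<and>
     (\<forall>p\<in>carrier R. \<forall>q\<in>I. p * q \<in> I)" (is "_ \<longleftrightarrow> ?rhs")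
proof
  interpret cring R by (rule cring)
  assume "ideal I R"
  then interpret ideal I R .
  show ?rhs
    using a_subset additive_subgroup.a_closed[OF is_additive_subgroup]
      additive_subgroup.zero_closed[OF is_additive_subgroup] I_l_closed by auto
next
  interpret cring R by (rule cring)
  assume I: ?rhs
  show "ideal I R"
  proof (rule idealI)
    show "ring R" by (rule ring_axioms)
    show "subgroup I (add_monoid R)"
    proof (rule add.subgroupI)
      fix p assume "p \<in> I"
      then have p: "p \<in> carrier R" "(- 1) * p \<in> I"
        using I uminus_in[OF one_in] by blast+
      then have "\<ominus>\<^bsub>R\<^esub> p = - p"
        by (intro minus_equality) auto
      then show "\<ominus>\<^bsub>R\<^esub> p \<in> I"
        using p by simp
    qed (use I in auto)
  next
    fix p q assume "p \<in> I" "q \<in> carrier R"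
    then show "q \<otimes>\<^bsub>R\<^esub> p \<in> I" "p \<otimes>\<^bsub>R\<^esub> q \<in> I"
      using I by (auto simp: mult.commute[of p q])
  qed
qed

context
  fixes I assumes I: "ideal I R"
begin

lemma ideal_subset: "p \<in> I \<Longrightarrow> p \<in> carrier R"
  and ideal_zero: "0 \<in> I"
  and ideal_add: "p \<in> I \<Longrightarrow> q \<in> I \<Longrightarrow> p + q \<in> I"
  and ideal_mult: "p \<in> carrier R \<Longrightarrow> q \<in> I \<Longrightarrow> p * q \<in> I"
  using I unfolding ideal_iff by auto

lemma ideal_uminus: "p \<in> I \<Longrightarrow> - p \<in> I"
  using ideal_mult[of "- 1" p] uminus_in[OF one_in] by simp

lemma ideal_diff: "p \<in> I \<Longrightarrow> q \<in> I \<Longrightarrow> p - q \<in> I"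
  using ideal_add[of p "- q"] ideal_uminus by simp

lemma ideal_sum: "(\<And>i. i \<in> A \<Longrightarrow> f i \<in> I) \<Longrightarrow> (\<Sum>i\<in>A. f i) \<in> I"
  by (induction A rule: infinite_finite_induct) (auto simp: ideal_zero ideal_add)

end

lemma ideal_genideal: "S \<subseteq> carrier R \<Longrightarrow> ideal (genideal R S) R"
  using ring.genideal_ideal[OF cring.axioms(1)[OF cring]] .

lemma genideal_superset: "S \<subseteq> genideal R S"
  by (auto simp: genideal_def)

lemma genideal_least: "ideal J R \<Longrightarrow> S \<subseteq> J \<Longrightarrow> genideal R S \<subseteq> J"
  by (auto simp: genideal_def)

end

section \<open>Hilbert's Nullstellensatz over a subfield of the complex numbers\<close>

context mpolys_over_subfield
begin

text \<open>A \<open>K\<close>-subspace \<open>W\<close> maximal among those avoiding 1 is a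
  complement of \<open>K\<close>, so every \<open>z\<close> is uniquely an element of
  \<open>W\<close> plus some \<open>k\<close> in \<open>K\<close>, and \<pi> reads off
  \<open>k\<close>.\<close>

lemma exists_linear_projection:
  "\<exists>\<pi>. (\<forall>z. \<pi> z \<in> K) \<and> (\<forall>w z. \<pi> (w + z) = \<pi> w + \<pi> z) \<and> (\<forall>z. \<forall>c\<in>K. \<pi> (z * c) = \<pi> z * c) \<and> \<pi> 1 = 1"
proof -
  define \<A> where "\<A> = {W. 0 \<in> W \<and> (\<forall>x\<in>W. \<forall>y\<in>W. x + y \<in> W) \<and> (\<forall>x\<in>W. \<forall>c\<in>K. x * c \<in> W) \<and> 1 \<notin> W}"
  have "\<exists>W\<in>\<A>. \<forall>U\<in>\<A>. W \<subseteq> U \<longrightarrow> U = W"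
  proof (rule subset_Zorn_nonempty)
    have "{0} \<in> \<A>"
      by (simp add: \<A>_def)
    then show "\<A> \<noteq> {}"
      by blast
    fix \<C> assume \<C>: "\<C> \<noteq> {}" "subset.chain \<A> \<C>"
    have "x + y \<in> \<Union>\<C>" if "x \<in> \<Union>\<C>" "y \<in> \<Union>\<C>" for x y
    proof -
      obtain U Y where UY: "U \<in> \<C>" "x \<in> U" "Y \<in> \<C>" "y \<in> Y"
        using \<open>x \<in> \<Union>\<C>\<close> \<open>y \<in> \<Union>\<C>\<close> by blast
      then have "U \<subseteq> Y \<or> Y \<subseteq> U" "U \<in> \<A>" "Y \<in> \<A>"
        using \<C>(2) by (auto simp: subset.chain_def)
      then show ?thesis
        using UY unfolding \<A>_def by blast
    qed
    moreover have "\<C> \<subseteq> \<A>"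
      using \<C>(2) by (auto simp: subset.chain_def)
    then have "0 \<in> \<Union>\<C>" "1 \<notin> \<Union>\<C>" "\<And>x c. x \<in> \<Union>\<C> \<Longrightarrow> c \<in> K \<Longrightarrow> x * c \<in> \<Union>\<C>"
      using \<C>(1) unfolding \<A>_def by blast+
    ultimately show "\<Union>\<C> \<in> \<A>"
      by (simp add: \<A>_def)
  qed
  then obtain W where "W \<in> \<A>" and max: "\<And>U. U \<in> \<A> \<Longrightarrow> W \<subseteq> U \<Longrightarrow> U = W"
    by blast
  then have W: "0 \<in> W" "\<And>x y. x \<in> W \<Longrightarrow> y \<in> W \<Longrightarrow> x + y \<in> W" "\<And>x c. x \<in> W \<Longrightarrow> c \<in> K \<Longrightarrow> x * c \<in> W"
    "1 \<notin> W"
    by (auto simp: \<A>_def)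
  have W_diff: "x - y \<in> W" if "x \<in> W" "y \<in> W" for x y
    using W(2)[OF that(1) W(3)[OF that(2) uminus_coeff[OF one_coeff]]] by simp
  \<comment> \<open>For \<open>z\<close> outside \<open>W\<close>, maximality puts 1 into
    \<open>W + zK\<close>, say \<open>1 = w + z * c\<close>. Here \<open>c\<close> is nonzero
    because 1 is not in \<open>W\<close>, and dividing by \<open>c\<close> gives
    \<open>k = inverse c\<close>.\<close>
  have ex: "\<exists>k\<in>K. z - k \<in> W" for z
  proof (cases "z \<in> W")
    case True
    then show ?thesis by (intro bexI[of _ 0]) auto
  next
    case False
    define U where "U = {w + z * c | w c. w \<in> W \<and> c \<in> K}"
    have UI: "w + z * c \<in> U" if "w \<in> W" "c \<in> K" for w c
      unfolding U_def using that by blast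
    have "W \<subseteq> U"
      using UI[of _ 0] by auto
    moreover have "z \<in> U"
      using UI[OF W(1), of 1] by simp
    ultimately have "U \<notin> \<A>"
      using max[of U] False by blast
    moreover have "x + y \<in> U" if xy: "x \<in> U" "y \<in> U" for x y
    proof -
      obtain w c w' c' where "x = w + z * c" "y = w' + z * c'" "w \<in> W" "w' \<in> W" "c \<in> K" "c' \<in> K"
        using xy by (auto simp: U_def)
      then show ?thesis
        using UI[OF W(2)[of w w'] add_coeff[of c c']] by (simp add: algebra_simps)
    qed
    moreover have "x * d \<in> U" if xd: "x \<in> U" "d \<in> K" for x d
    proof -
      obtain w c where "x = w + z * c" "w \<in> W" "c \<in> K"
        using xd by (auto simp: U_def)
      then show ?thesis
        using UI[OF W(3)[of w d] mult_coeff[of c d]] xd by (simp add: algebra_simps)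
    qed
    ultimately have "1 \<in> U"
      using W(1) \<open>W \<subseteq> U\<close> unfolding \<A>_def by blast
    then obtain w c where wc: "1 = w + z * c" "w \<in> W" "c \<in> K"
      by (auto simp: U_def)
    then have "c \<noteq> 0"
      using W(4) by auto
    have "w = 1 - z * c"
      using wc(1) by (simp add: eq_diff_eq)
    moreover have "z - inverse c = (1 - z * c) * (- inverse c)"
      using \<open>c \<noteq> 0\<close> by (simp add: field_simps)
    ultimately have "z - inverse c = w * (- inverse c)"
      by simp
    then show ?thesis
      using W(3)[OF wc(2), of "- inverse c"] wc(3) by (intro bexI[of _ "inverse c"]) auto
  qed
  \<comment> \<open>A nonzero element of \<open>K\<close> lying in \<open>W\<close> could be scaled
    to 1.\<close>
  have uniq: "k = l" if kl: "k \<in> K" "l \<in> K" "z - k \<in> W" "z - l \<in> W" for k l z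
  proof (rule ccontr)
    assume "k \<noteq> l"
    have "k - l \<in> W"
      using W_diff[OF kl(4,3)] by simp
    then have "(k - l) * inverse (k - l) \<in> W"
      using kl by (intro W(3)) auto
    then show False
      using W(4) \<open>k \<noteq> l\<close> by simp
  qed
  define \<pi> where "\<pi> z = (THE k. k \<in> K \<and> z - k \<in> W)" for z
  have \<pi>_eq: "\<pi> z = k" if "k \<in> K" "z - k \<in> W" for z k
    unfolding \<pi>_def using that uniq by (intro the_equality) blast+
  have \<pi>: "\<pi> z \<in> K" "z - \<pi> z \<in> W" for z
    using ex[of z] \<pi>_eq by metis+
  have "\<pi> (w + z) = \<pi> w + \<pi> z" for w z
    using W(2)[OF \<pi>(2)[of w] \<pi>(2)[of z]] \<pi>(1) by (intro \<pi>_eq) (auto simp: algebra_simps)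
  moreover have "\<pi> (z * c) = \<pi> z * c" if "c \<in> K" for z c
    using W(3)[OF \<pi>(2)[of z] that] \<pi>(1) that by (intro \<pi>_eq) (auto simp: algebra_simps)
  moreover have "\<pi> 1 = 1"
    by (intro \<pi>_eq) (auto simp: W)
  ultimately show ?thesis
    using \<pi>(1) by blast
qed

text \<open>The last conjunct says that the quotient by \<open>M\<close> is a field, without forming
  the quotient.\<close>

lemma exists_maximal_ideal:
  assumes "ideal I R" and "1 \<notin> I"
  shows "\<exists>M. ideal M R \<and> I \<subseteq> M \<and> 1 \<notin> M \<and>
    (\<forall>p\<in>carrier R. p \<notin> M \<longrightarrow> (\<exists>q\<in>carrier R. q * p - 1 \<in> M))"
proof -
  define \<A> where "\<A> = {M. ideal M R \<and> I \<subseteq> M \<and> 1 \<notin> M}"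
  have "\<exists>M\<in>\<A>. \<forall>U\<in>\<A>. M \<subseteq> U \<longrightarrow> U = M"
  proof (rule subset_Zorn_nonempty)
    show "\<A> \<noteq> {}"
      using assms by (auto simp: \<A>_def)
    fix \<C> assume \<C>: "\<C> \<noteq> {}" "subset.chain \<A> \<C>"
    then have sub: "\<C> \<subseteq> \<A>"
      by (auto simp: subset.chain_def)
    have "p + q \<in> \<Union>\<C>" if pq: "p \<in> \<Union>\<C>" "q \<in> \<Union>\<C>" for p q
    proof -
      obtain U Y where UY: "U \<in> \<C>" "p \<in> U" "Y \<in> \<C>" "q \<in> Y"
        using pq by blast
      then have "U \<subseteq> Y \<or> Y \<subseteq> U" "ideal U R" "ideal Y R"
        using \<C>(2) by (auto simp: subset.chain_def \<A>_def)
      then show ?thesis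
        using UY by (meson UnionI ideal_add subsetD)
    qed
    moreover have "\<Union>\<C> \<subseteq> carrier R" "0 \<in> \<Union>\<C>" "\<forall>p\<in>carrier R. \<forall>q\<in>\<Union>\<C>. p * q \<in> \<Union>\<C>"
      using \<C>(1) sub unfolding \<A>_def ideal_iff by blast+
    ultimately have "ideal (\<Union>\<C>) R"
      unfolding ideal_iff by blast
    then show "\<Union>\<C> \<in> \<A>"
      using \<C>(1) sub unfolding \<A>_def by blast
  qed
  then obtain M where M: "M \<in> \<A>" and max: "\<And>U. U \<in> \<A> \<Longrightarrow> M \<subseteq> U \<Longrightarrow> U = M"
    by blast
  then have idl: "ideal M R"
    by (auto simp: \<A>_def)
  have "\<exists>q\<in>carrier R. q * p - 1 \<in> M" if p: "p \<in> carrier R" "p \<notin> M" for p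
  proof -
    \<comment> \<open>The ideal generated by \<open>M\<close> and \<open>p\<close>; maximality
      forces 1 into it, which exhibits an inverse of \<open>p\<close> modulo
      \<open>M\<close>.\<close>
    define U where "U = {m + q * p | m q. m \<in> M \<and> q \<in> carrier R}"
    have UI: "m + q * p \<in> U" if "m \<in> M" "q \<in> carrier R" for m q
      unfolding U_def using that by blast
    have "M \<subseteq> U"
      using UI[of _ 0] by auto
    moreover have "p \<in> U"
      using UI[of 0 1] ideal_zero[OF idl] by simp
    ultimately have "U \<notin> \<A>"
      using max[of U] p(2) by blast
    moreover have "ideal U R"
      unfolding ideal_iff
    proof (intro conjI ballI subsetI)
      show "x \<in> carrier R" if "x \<in> U" for x
        using that p(1) ideal_subset[OF idl] unfolding U_def by blast
      show "0 \<in> U"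
        using UI[of 0 0] ideal_zero[OF idl] by simp
    next
      fix x y assume "x \<in> U" "y \<in> U"
      then obtain m q m' q' where *: "x = m + q * p" "y = m' + q' * p"
        "m \<in> M" "m' \<in> M" "q \<in> carrier R" "q' \<in> carrier R"
        unfolding U_def by blast
      then have "x + y = (m + m') + (q + q') * p"
        by (simp add: algebra_simps)
      then show "x + y \<in> U"
        using UI[of "m + m'" "q + q'"] * ideal_add[OF idl] add_in by metis
    next
      fix f y assume f: "f \<in> carrier R" and "y \<in> U"
      then obtain m q where *: "y = m + q * p" "m \<in> M" "q \<in> carrier R"
        unfolding U_def by blast
      then have "f * y = f * m + (f * q) * p"
        by (simp add: algebra_simps)
      then show "f * y \<in> U"
        using UI[of "f * m" "f * q"] * f ideal_mult[OF idl] mult_in by metis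
    qed
    ultimately have "1 \<in> U"
      using M \<open>M \<subseteq> U\<close> unfolding \<A>_def by blast
    then obtain m q where mq: "1 = m + q * p" "m \<in> M" "q \<in> carrier R"
      by (auto simp: U_def)
    then have "q * p - 1 = - m"
      by (simp add: algebra_simps)
    then show ?thesis
      using mq ideal_uminus[OF idl, of m] by metis
  qed
  then show ?thesis
    using M unfolding \<A>_def by blast
qed

end

section \<open>The complex case, by counting monomials against scalars\<close>

lemma countable_monomials: "countable (UNIV :: ('v::countable \<Rightarrow>\<^sub>0 nat) set)"
proof -
  \<comment> \<open>A monomial is determined by the finite set of pairs of a variable and its
    nonzero exponent, and a countable type has only countably many finite subsets.\<close>
  let ?graph = "\<lambda>s :: 'v \<Rightarrow>\<^sub>0 nat. (\<lambda>v. (v, Poly_Mapping.lookup s v)) ` Poly_Mapping.keys s"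
  have "inj ?graph"
  proof (rule injI, rule poly_mapping_eqI)
    fix s t :: "'v \<Rightarrow>\<^sub>0 nat" and v assume eq: "?graph s = ?graph t"
    have *: "(v, n) \<in> ?graph u \<longleftrightarrow> n = Poly_Mapping.lookup u v \<and> n \<noteq> 0" for n u
      by (auto simp: in_keys_iff)
    show "Poly_Mapping.lookup s v = Poly_Mapping.lookup t v"
      using *[of "Poly_Mapping.lookup s v" s] *[of "Poly_Mapping.lookup s v" t]
        *[of "Poly_Mapping.lookup t v" s] *[of "Poly_Mapping.lookup t v" t] eq by metis
  qed
  moreover have "countable (range ?graph)"
    by (rule countable_subset[OF _ countable_Collect_finite]) auto
  ultimately show ?thesis
    using countable_image_inj_on by blast
qed

lemma const_poly_hom:
  "const_poly (a + b) = const_poly a + const_poly b" "const_poly (a * b) = const_poly a * const_poly b"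
  "const_poly 0 = 0" "const_poly 1 = 1" "const_poly (- a) = - const_poly a"
  "const_poly (a - b) = const_poly a - const_poly b"
  for a b :: "'r::comm_ring_1"
  by (auto simp: const_poly_def single_add mult_single single_uminus single_diff)

text \<open>The algebra homomorphism sending the univariate indeterminate to \<open>x\<close>. It
  transports factorizations over the complex numbers into the multivariate ring.\<close>

definition subst_poly :: "('v, 'r::comm_ring_1) mpoly \<Rightarrow> 'r poly \<Rightarrow> ('v, 'r) mpoly" where
  "subst_poly x p = poly (map_poly const_poly p) x"

lemma subst_poly_pCons: "subst_poly x (pCons a p) = const_poly a + x * subst_poly x p"
  by (simp add: subst_poly_def map_poly_pCons const_poly_hom)

lemma subst_poly_0 [simp]: "subst_poly x 0 = 0"
  by (simp add: subst_poly_def)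

lemma subst_poly_1 [simp]: "subst_poly x 1 = 1"
  using subst_poly_pCons[of x 1 0] by (simp add: const_poly_hom one_pCons)

lemma subst_poly_add: "subst_poly x (p + q) = subst_poly x p + subst_poly x q"
proof (induction p arbitrary: q)
  case (pCons a p)
  show ?case
  proof (cases q)
    case q: (pCons b r)
    show ?thesis
      by (simp add: q subst_poly_pCons pCons.IH const_poly_hom algebra_simps)
  qed
qed simp

lemma subst_poly_smult: "subst_poly x (Polynomial.smult c p) = const_poly c * subst_poly x p"
  by (induction p) (auto simp: subst_poly_pCons const_poly_hom algebra_simps)

lemma subst_poly_mult: "subst_poly x (p * q) = subst_poly x p * subst_poly x q"
proof (induction p)
  case (pCons a p)
  then show ?case
    by (simp add: mult_pCons_left subst_poly_add subst_poly_smult subst_poly_pCons const_poly_hom algebra_simps)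
qed simp

lemma subst_poly_sum: "subst_poly x (\<Sum>i\<in>A. f i) = (\<Sum>i\<in>A. subst_poly x (f i))"
  by (induction A rule: infinite_finite_induct) (auto simp: subst_poly_add)

lemma subst_poly_prod: "subst_poly x (\<Prod>i\<in>A. f i) = (\<Prod>i\<in>A. subst_poly x (f i))"
  by (induction A rule: infinite_finite_induct) (auto simp: subst_poly_mult)

lemma subst_poly_linear: "subst_poly x [:- c, 1:] = x - const_poly c"
  by (simp add: subst_poly_pCons const_poly_hom)

text \<open>Gives access to span and linear dependence with scalars acting through constant
  polynomials.\<close>

interpretation mpoly_vs: vector_space "\<lambda>(c::'r::field) (p :: ('v, 'r) mpoly). const_poly c * p"
  by standard (auto simp: const_poly_hom algebra_simps)

interpretation full: mpolys_over_subfield "UNIV :: complex set" "UNIV :: 'v set"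
proof (rule mpolys_over_subfield.intro)
  interpret field "ring_of_type_algebra :: complex ring"
    by (rule field_from_type_algebra)
  show "subfield (UNIV :: complex set) ring_of_type_algebra"
    by (intro subfieldI' subringI) (auto simp: ring_of_type_algebra_def)
qed

lemma full_carrier [simp]: "carrier (mpoly_ring (UNIV :: complex set) UNIV) = UNIV"
  by (auto simp: full.in_carrier_iff monomials_def)

text \<open>An inverse \<open>Q c\<close> of \<open>X\<^sub>v - c\<close> modulo \<open>M\<close> for all of the uncountably many \<open>c\<close> would yield
  infinitely many \<open>Q c\<close> with the same finite set of monomials, hence linearly dependent. Clearing
  denominators in a linear relation gives a nonzero univariate polynomial in \<open>X\<^sub>v\<close> that lies in \<open>M\<close>, and
  one of its linear factors lies in \<open>M\<close> as well.\<close>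

lemma maximal_ideal_contains_linear:
  fixes M :: "('v::countable, complex) mpoly set"
  assumes idl: "ideal M (mpoly_ring UNIV UNIV)" and proper: "1 \<notin> M"
    and max: "\<And>p. p \<notin> M \<Longrightarrow> \<exists>q. q * p - 1 \<in> M"
  shows "\<exists>c. var_poly v - const_poly c \<in> M"
proof (rule ccontr)
  let ?X = "var_poly v :: ('v, complex) mpoly"
  assume "\<nexists>c. ?X - const_poly c \<in> M"
  then have notin: "?X - const_poly c \<notin> M" for c
    by blast
  have mult: "p * q \<in> M" if "q \<in> M" for p q
    using full.ideal_mult[OF idl] that by simp
  note add = full.ideal_add[OF idl] and diff = full.ideal_diff[OF idl] and sum = full.ideal_sum[OF idl]
  \<comment> \<open>Maximal ideals are prime: \<open>a\<close> inverts \<open>p\<close> modulo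
    \<open>M\<close>, so \<open>q\<close> is congruent to \<open>a * (p * q)\<close>.\<close>
  have prime: "q \<in> M" if pq: "p * q \<in> M" "p \<notin> M" for p q
  proof -
    obtain a where a: "a * p - 1 \<in> M"
      using max[OF pq(2)] by blast
    have "q = a * (p * q) - q * (a * p - 1)"
      by (simp add: algebra_simps)
    then show ?thesis
      using diff[OF mult[OF pq(1), of a] mult[OF a, of q]] by simp
  qed
  have const: "c = 0" if "const_poly c \<in> M" for c
  proof (rule ccontr)
    assume "c \<noteq> 0"
    then have "const_poly (inverse c) * const_poly c = (1 :: ('v, complex) mpoly)"
      by (simp flip: const_poly_hom)
    then show False
      using mult[OF that, of "const_poly (inverse c)"] proper by simp
  qed
  \<comment> \<open>Under the contrary assumption the variable is transcendental modulo
    \<open>M\<close>: roots are split off one at a time, and primality discards each linear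
    factor.\<close>
  have no_root: "p = 0" if "subst_poly ?X p \<in> M" for p
    using that
  proof (induction "Polynomial.degree p" arbitrary: p)
    case 0
    then obtain a where "p = [:a:]"
      by (metis degree_eq_zeroE)
    then show ?case
      using 0 const[of a] by (simp add: subst_poly_pCons)
  next
    case (Suc n)
    obtain z where "poly p z = 0"
      using alg_closed_imp_poly_has_root[of p] Suc(2) by auto
    then obtain q where q: "p = [:- z, 1:] * q"
      by (auto simp: poly_eq_0_iff_dvd)
    have "q \<noteq> 0"
      using Suc(2) q by auto
    then have "Polynomial.degree p = Suc (Polynomial.degree q)"
      using q degree_mult_eq[of "[:- z, 1:]" q] by simp
    moreover have "subst_poly ?X q \<in> M"
    proof (rule prime[of "?X - const_poly z"])
      show "(?X - const_poly z) * subst_poly ?X q \<in> M"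
        using Suc(3) unfolding q subst_poly_mult subst_poly_linear .
    qed (rule notin)
    ultimately show ?case
      using Suc(1)[of q] Suc(2) \<open>q \<noteq> 0\<close> by simp
  qed
  obtain Q where Q: "\<And>c. Q c * (?X - const_poly c) - 1 \<in> M"
    using max[OF notin] by metis
  \<comment> \<open>If \<open>c\<close> and \<open>d\<close> shared an inverse, subtracting the two
    congruences would put \<open>(d - c) * Q c\<close>, hence \<open>Q c\<close>, hence 1 into
    \<open>M\<close>.\<close>
  have inj: "inj Q"
  proof (rule injI, rule ccontr)
    fix c d assume cd: "Q c = Q d" "c \<noteq> d"
    have "Q c * (?X - const_poly c) - 1 - (Q d * (?X - const_poly d) - 1) = const_poly (d - c) * Q c"
      using cd(1) by (simp add: const_poly_hom algebra_simps)
    then have "const_poly (d - c) * Q c \<in> M"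
      using diff[OF Q[of c] Q[of d]] by simp
    then have "Q c \<in> M"
      by (rule prime) (use const[of "d - c"] cd(2) in auto)
    then have "(?X - const_poly c) * Q c - (Q c * (?X - const_poly c) - 1) \<in> M"
      using diff[OF mult Q] by blast
    then show False
      using proper by (simp add: algebra_simps)
  qed
  let ?F = "\<lambda>c. Poly_Mapping.keys (Q c)"
  \<comment> \<open>Pigeonhole: uncountably many scalars but countably many supports, so some
    support \<open>F\<close> is shared by uncountably many \<open>Q c\<close>.\<close>
  have "countable (range ?F)"
    by (rule countable_subset[OF _ countable_Collect_finite_subset[OF countable_monomials]]) auto
  then obtain F where F: "F \<in> range ?F" "uncountable {c. ?F c = F}"
  proof -
    have "UNIV = (\<Union>F\<in>range ?F. {c. ?F c = F})"
      by auto
    then have "uncountable (\<Union>F\<in>range ?F. {c. ?F c = F})"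
      using uncountable_UNIV_complex by simp
    then show ?thesis
      using that \<open>countable (range ?F)\<close> by (meson countable_UN)
  qed
  define D where "D = {c. ?F c = F}"
  have "finite F"
    using F(1) by auto
  have "infinite D"
    using F(2) countable_finite unfolding D_def by blast
  then have "infinite (Q ` D)"
    using inj finite_imageD inj_on_subset by blast
  have "Q ` D \<subseteq> mpoly_vs.span ((\<lambda>s. Poly_Mapping.single s 1) ` F)"
  proof (rule image_subsetI)
    fix c assume "c \<in> D"
    then have "Q c = (\<Sum>s\<in>F. Poly_Mapping.single s (Poly_Mapping.lookup (Q c) s))"
      using poly_mapping_sum_single[of "Q c"] by (simp add: D_def)
    also have "\<dots> = (\<Sum>s\<in>F. const_poly (Poly_Mapping.lookup (Q c) s) * Poly_Mapping.single s 1)"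
      by (simp add: const_poly_def mult_single)
    also have "\<dots> \<in> mpoly_vs.span ((\<lambda>s. Poly_Mapping.single s 1) ` F)"
      by (intro mpoly_vs.span_sum mpoly_vs.span_scale mpoly_vs.span_base) auto
    finally show "Q c \<in> mpoly_vs.span ((\<lambda>s. Poly_Mapping.single s 1) ` F)" .
  qed
  then have "mpoly_vs.dependent (Q ` D)"
    using mpoly_vs.independent_span_bound[of _ "Q ` D"] \<open>finite F\<close> \<open>infinite (Q ` D)\<close> by blast
  then obtain t u q where t: "finite t" "t \<subseteq> Q ` D" "(\<Sum>q\<in>t. const_poly (u q) * q) = 0" "q \<in> t" "u q \<noteq> 0"
    unfolding mpoly_vs.dependent_explicit by blast
  \<comment> \<open>The relation is indexed by values of \<open>Q\<close>; injectivity allows it to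
    be reindexed by the scalars themselves.\<close>
  obtain E where E: "finite E" "t = Q ` E"
    using t(1,2) by (meson finite_subset_image)
  obtain e where e: "e \<in> E" "u (Q e) \<noteq> 0"
    using t(4,5) E(2) by blast
  have rel: "(\<Sum>c\<in>E. const_poly (u (Q c)) * Q c) = 0"
    using t(3) unfolding E(2) by (subst (asm) sum.reindex) (use inj in \<open>auto intro: inj_on_subset\<close>)
  \<comment> \<open>The numerator of the sum of \<open>u (Q c) / (X - c)\<close> over the common
    denominator. Evaluation at \<open>e\<close> kills every summand except that of \<open>e\<close>,
    so this numerator is not the zero polynomial.\<close>
  define p where "p = (\<Sum>c\<in>E. Polynomial.smult (u (Q c)) (\<Prod>d\<in>E - {c}. [:- d, 1:]))"
  define P where "P c = (\<Prod>d\<in>E - {c}. ?X - const_poly d)" for c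
  have "poly p e = (\<Sum>c\<in>E. u (Q c) * (\<Prod>d\<in>E - {c}. e - d))"
    by (simp add: p_def poly_sum poly_prod)
  also have "\<dots> = (\<Sum>c\<in>{e}. u (Q c) * (\<Prod>d\<in>E - {c}. e - d))"
    using E(1) e(1) by (intro sum.mono_neutral_right) auto
  also have "\<dots> \<noteq> 0"
    using e(2) E(1) by simp
  finally have "p \<noteq> 0"
    by auto
  have "subst_poly ?X p = (\<Sum>c\<in>E. const_poly (u (Q c)) * P c)"
    by (simp only: p_def P_def subst_poly_sum subst_poly_smult subst_poly_prod subst_poly_linear)
  \<comment> \<open>Since \<open>Q c\<close> stands for \<open>1 / (X - c)\<close> modulo
    \<open>M\<close>, multiplying the linear relation by the common denominator gives the numerator,
    up to multiples of the elements \<open>Q c * (X - c) - 1\<close> of \<open>M\<close>.\<close>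
  also have "\<dots> = (\<Prod>d\<in>E. ?X - const_poly d) * (\<Sum>c\<in>E. const_poly (u (Q c)) * Q c) -
      (\<Sum>c\<in>E. (const_poly (u (Q c)) * P c) * (Q c * (?X - const_poly c) - 1))"
  proof -
    have eq: "(\<Prod>d\<in>E. ?X - const_poly d) = (?X - const_poly c) * P c" if "c \<in> E" for c
      unfolding P_def using E(1) that by (rule prod.remove)
    have "(\<Prod>d\<in>E. ?X - const_poly d) * (\<Sum>c\<in>E. const_poly (u (Q c)) * Q c) =
      (\<Sum>c\<in>E. const_poly (u (Q c)) * P c + (const_poly (u (Q c)) * P c) * (Q c * (?X - const_poly c) - 1))"
      unfolding sum_distrib_left by (intro sum.cong refl) (simp only: eq, simp add: algebra_simps)
    then show ?thesis
      by (simp add: sum.distrib)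
  qed
  also have "\<dots> \<in> M"
    unfolding rel by (intro diff[OF _ sum[OF mult[OF Q]]]) (simp add: full.ideal_zero[OF idl])
  finally show False
    using no_root \<open>p \<noteq> 0\<close> by blast
qed

text \<open>A maximal ideal above \<open>J\<close> contains one linear polynomial for each variable.
  Modulo it every polynomial is congruent to its value at the resulting point, and a nonzero value
  on \<open>J\<close> would be a unit in the ideal.\<close>

lemma weak_nullstellensatz_complex:
  fixes J :: "('v::countable, complex) mpoly set"
  assumes J: "ideal J (mpoly_ring UNIV UNIV)" "1 \<notin> J"
  shows "\<exists>x. \<forall>p\<in>J. eval_mpoly x p = 0"
proof -
  obtain M where M: "ideal M (mpoly_ring UNIV UNIV)" "J \<subseteq> M" "1 \<notin> M" "\<And>p. p \<notin> M \<Longrightarrow> \<exists>q. q * p - 1 \<in> M"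
    using full.exists_maximal_ideal[OF J] by auto
  have mult: "p * q \<in> M" if "q \<in> M" for p q
    using full.ideal_mult[OF M(1)] that by simp
  obtain x where x: "\<And>v. var_poly v - const_poly (x v) \<in> M"
    using maximal_ideal_contains_linear[OF M(1,3,4)] by metis
  have reduce: "p - const_poly (eval_mpoly x p) \<in> M" for p
  proof (induction p rule: mpoly_induct)
    case (const c)
    show ?case using full.ideal_zero[OF M(1)] by simp
  next
    case (var v)
    show ?case using x by simp
  next
    case (add p q)
    then show ?case
      using full.ideal_add[OF M(1) add] by (simp add: const_poly_hom algebra_simps)
  next
    case (mult p q)
    \<comment> \<open>The factors are replaced by their values one after the other.\<close>
    have "p * q - const_poly (eval_mpoly x (p * q)) =
        q * (p - const_poly (eval_mpoly x p)) + const_poly (eval_mpoly x p) * (q - const_poly (eval_mpoly x q))"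
      by (simp add: const_poly_hom algebra_simps)
    then show ?case
      using full.ideal_add[OF M(1) \<open>\<And>q p. q \<in> M \<Longrightarrow> p * q \<in> M\<close>[OF mult(1), of q]
        \<open>\<And>q p. q \<in> M \<Longrightarrow> p * q \<in> M\<close>[OF mult(2), of "const_poly (eval_mpoly x p)"]] by simp
  qed
  have "eval_mpoly x p = 0" if "p \<in> J" for p
  proof (rule ccontr)
    assume nz: "eval_mpoly x p \<noteq> 0"
    have "const_poly (eval_mpoly x p) \<in> M"
      using full.ideal_diff[OF M(1) _ reduce[of p], of p] that M(2) by auto
    then have "const_poly (inverse (eval_mpoly x p)) * const_poly (eval_mpoly x p) \<in> M"
      by (rule mult)
    then show False
      using nz M(3) by (simp flip: const_poly_hom)
  qed
  then show ?thesis
    by blast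
qed

text \<open>A \<open>K\<close>-linear projection \<open>\<pi>\<close> from the complex numbers onto \<open>K\<close> extends to a \<open>K[V]\<close>-linear projection
  \<open>proj\<close> of the full polynomial ring onto \<open>K[V]\<close>. The polynomials all of whose multiples are mapped into \<open>I\<close>
  by \<open>proj\<close> form a proper ideal that contains \<open>I\<close>.\<close>

theorem weak_nullstellensatz_subfield:
  fixes I :: "('v::countable, complex) mpoly set"
  assumes K: "subfield K ring_of_type_algebra"
    and I: "ideal I (mpoly_ring K V)" "1 \<notin> I"
  shows "\<exists>x. \<forall>p\<in>I. eval_mpoly x p = 0"
proof -
  interpret mpolys_over_subfield K V
    by (intro mpolys_over_subfield.intro K)
  obtain \<pi> where \<pi>: "\<And>z. \<pi> z \<in> K" "\<And>w z. \<pi> (w + z) = \<pi> w + \<pi> z"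
    "\<And>z c. c \<in> K \<Longrightarrow> \<pi> (z * c) = \<pi> z * c" "\<pi> 1 = 1"
    using exists_linear_projection by metis
  have \<pi>_0: "\<pi> 0 = 0"
    using \<pi>(3)[of 0 0] by simp
  \<comment> \<open>Coefficients are sent through \<pi>, and monomials involving a variable outside
    \<open>V\<close> are dropped.\<close>
  define proj :: "('v, complex) mpoly \<Rightarrow> ('v, complex) mpoly"
    where "proj = Poly_Mapping.mapp (\<lambda>s c. \<pi> c when s \<in> monomials V)"
  have lookup_proj: "Poly_Mapping.lookup (proj p) s = (\<pi> (Poly_Mapping.lookup p s) when s \<in> monomials V)" for p s
    by (auto simp: proj_def lookup_mapp in_keys_iff when_def \<pi>_0)
  have proj_carrier: "proj p \<in> carrier R" for p
    by (auto simp: in_carrier_iff in_keys_iff lookup_proj when_def \<pi> split: if_splits)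
  have proj_add: "proj (p + q) = proj p + proj q" for p q
    by (rule poly_mapping_eqI) (auto simp: lookup_proj lookup_add \<pi> when_def)
  have proj_0: "proj 0 = 0"
    by (rule poly_mapping_eqI) (simp add: lookup_proj \<pi>_0)
  have proj_sum: "proj (\<Sum>i\<in>A. f i) = (\<Sum>i\<in>A. proj (f i))" for f :: "'w \<Rightarrow> _" and A
    by (induction A rule: infinite_finite_induct) (auto simp: proj_add proj_0)
  have proj_single: "proj (Poly_Mapping.single s c) = Poly_Mapping.single s (\<pi> c when s \<in> monomials V)" for s c
    by (rule poly_mapping_eqI) (auto simp: lookup_proj lookup_single when_def \<pi>_0)
  \<comment> \<open>Linearity of \<pi> handles the coefficient. For \<open>s\<close> in
    \<open>V\<close>, a product with \<open>s\<close> is a monomial in \<open>V\<close> exactly when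
    the other factor is, so dropping monomials commutes with the shift.\<close>
  have proj_mult_single: "proj (q * Poly_Mapping.single s c) = proj q * Poly_Mapping.single s c"
    if "s \<in> monomials V" "c \<in> K" for q s c
    by (induction q rule: poly_mapping_single_induct)
      (use that in \<open>auto simp: proj_0 proj_add distrib_right mult_single proj_single \<pi> monomials_add_iff when_def\<close>)
  have proj_mult: "proj (q * p) = proj q * p" if "p \<in> carrier R" for p q
  proof -
    have "proj (q * (\<Sum>s\<in>Poly_Mapping.keys p. Poly_Mapping.single s (Poly_Mapping.lookup p s))) =
      proj q * (\<Sum>s\<in>Poly_Mapping.keys p. Poly_Mapping.single s (Poly_Mapping.lookup p s))"
      unfolding sum_distrib_left proj_sum using that by (intro sum.cong proj_mult_single) auto
    then show ?thesis
      by (simp flip: poly_mapping_sum_single)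
  qed
  have proj_1: "proj 1 = 1"
    using proj_single[of 0 1] by (simp add: \<pi>)
  define J where "J = {p. \<forall>q. proj (q * p) \<in> I}"
  have "ideal J (mpoly_ring UNIV UNIV)"
    unfolding full.ideal_iff J_def
    by (auto simp: distrib_left proj_add proj_0 ideal_add[OF I(1)] ideal_zero[OF I(1)] simp flip: mult.assoc)
  moreover have "1 \<notin> J"
    using I(2) proj_1 by (auto simp: J_def intro: exI[of _ 1])
  ultimately obtain x where "\<And>p. p \<in> J \<Longrightarrow> eval_mpoly x p = 0"
    using weak_nullstellensatz_complex by blast
  \<comment> \<open>By \<open>proj_mult\<close>, the image of a multiple of \<open>p\<close> in
    \<open>I\<close> is a multiple of \<open>p\<close> within \<open>K[V]\<close>.\<close>
  moreover have "I \<subseteq> J"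
    using ideal_subset[OF I(1)] ideal_mult[OF I(1)] proj_carrier by (auto simp: J_def proj_mult)
  ultimately show ?thesis
    by blast
qed

section \<open>Reduced Groebner bases\<close>

subsection \<open>Dickson's lemma\<close>

text \<open>Some subsequence is monotone; if it decreases, it is constant from an index
  \<open>N\<close> of its least value onwards.\<close>

lemma nat_seq_mono_subseq:
  fixes f :: "nat \<Rightarrow> nat"
  shows "\<exists>\<phi>::nat \<Rightarrow> nat. strict_mono \<phi> \<and> mono (\<lambda>n. f (\<phi> n))"
proof -
  obtain \<phi> :: "nat \<Rightarrow> nat" where \<phi>: "strict_mono \<phi>" "monoseq (\<lambda>n. f (\<phi> n))"
    using seq_monosub[of f] by blast
  show ?thesis
  proof (cases "incseq (\<lambda>n. f (\<phi> n))")
    case True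
    then show ?thesis using \<phi>(1) by blast
  next
    case False
    then have dec: "decseq (\<lambda>n. f (\<phi> n))"
      using \<phi>(2) by (simp add: monoseq_iff)
    define N where "N = (ARG_MIN (\<lambda>n. f (\<phi> n)) n. True)"
    have "f (\<phi> N) \<le> f (\<phi> n)" for n
      unfolding N_def by (rule arg_min_nat_le) simp
    then have "f (\<phi> (N + n)) = f (\<phi> N)" for n
      using decseqD[OF dec, of N "N + n"] by (simp add: le_antisym)
    moreover have "strict_mono (\<lambda>n. \<phi> (N + n))"
      using \<phi>(1) by (simp add: strict_mono_def)
    ultimately show ?thesis
      by (intro exI[of _ "\<lambda>n. \<phi> (N + n)"]) (simp add: mono_def)
  qed
qed

text \<open>The subsequence is refined one variable at a time; monotonicity already achieved
  survives refinement.\<close>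

lemma Dickson_subseq:
  fixes f :: "nat \<Rightarrow> 'v \<Rightarrow> nat"
  assumes "finite V"
  shows "\<exists>\<phi>::nat \<Rightarrow> nat. strict_mono \<phi> \<and> (\<forall>v\<in>V. mono (\<lambda>n. f (\<phi> n) v))"
  using assms
proof (induction V rule: finite_induct)
  case empty
  show ?case by (intro exI[of _ id]) (simp add: strict_mono_def)
next
  case (insert v V)
  obtain \<phi> :: "nat \<Rightarrow> nat" where \<phi>: "strict_mono \<phi>" "\<And>w. w \<in> V \<Longrightarrow> mono (\<lambda>n. f (\<phi> n) w)"
    using insert.IH by blast
  obtain \<psi> :: "nat \<Rightarrow> nat" where \<psi>: "strict_mono \<psi>" "mono (\<lambda>n. f (\<phi> (\<psi> n)) v)"
    using nat_seq_mono_subseq[of "\<lambda>n. f (\<phi> n) v"] by blast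
  have "mono (\<lambda>n. f (\<phi> (\<psi> n)) w)" if "w \<in> V" for w
    using \<phi>(2)[OF that] strict_mono_mono[OF \<psi>(1)] by (simp add: mono_def)
  moreover have "strict_mono (\<lambda>n. \<phi> (\<psi> n))"
    using \<phi>(1) \<psi>(1) by (simp add: strict_mono_def)
  ultimately show ?case
    using \<psi>(2) by (intro exI[of _ "\<lambda>n. \<phi> (\<psi> n)"]) auto
qed

text \<open>An infinite set of exponents yields a sequence increasing in every variable, whose first
  two members are comparable under divisibility.\<close>

lemma Dickson:
  assumes "finite V" and "B \<subseteq> monomials V"
    and antichain: "\<And>s u. s \<in> B \<Longrightarrow> s + u \<in> B \<Longrightarrow> u = 0"
  shows "finite B"
proof (rule ccontr)
  assume "infinite B"
  then obtain f :: "nat \<Rightarrow> _" where f: "inj f" "range f \<subseteq> B"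
    using infinite_countable_subset by blast
  obtain \<phi> :: "nat \<Rightarrow> nat" where \<phi>: "strict_mono \<phi>" "\<And>v. v \<in> V \<Longrightarrow> mono (\<lambda>n. Poly_Mapping.lookup (f (\<phi> n)) v)"
    using Dickson_subseq[OF assms(1), of "\<lambda>n. Poly_Mapping.lookup (f n)"] by blast
  let ?s = "f (\<phi> 0)" and ?t = "f (\<phi> 1)"
  have in_B: "?s \<in> B" "?t \<in> B"
    using f(2) by auto
  have "Poly_Mapping.lookup ?s v \<le> Poly_Mapping.lookup ?t v" for v
  proof (cases "v \<in> V")
    case True
    then show ?thesis using \<phi>(2)[OF True] by (simp add: mono_def)
  next
    case False
    then have "v \<notin> Poly_Mapping.keys ?s"
      using in_B assms(2) by (auto simp: monomials_def)
    then show ?thesis by (simp add: in_keys_iff)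
  qed
  \<comment> \<open>The truncated subtraction of exponents is exact here because of the comparison
    just proved.\<close>
  then have eq: "?t = ?s + (?t - ?s)"
    by (intro poly_mapping_eqI) (simp add: lookup_add lookup_minus)
  then have "?t - ?s = 0"
    using antichain[of ?s "?t - ?s"] in_B by simp
  then have "?t = ?s"
    using eq by simp
  then have "\<phi> 1 = \<phi> 0"
    using f(1) by (simp add: inj_def)
  then show False
    using \<phi>(1) by (simp add: strict_mono_eq)
qed

subsection \<open>Leading monomials\<close>

lemma keys_diff_subset:
  fixes p q :: "'k \<Rightarrow>\<^sub>0 'r::ab_group_add"
  assumes "Poly_Mapping.lookup p s = Poly_Mapping.lookup q s"
  shows "Poly_Mapping.keys (p - q) \<subseteq> (Poly_Mapping.keys p \<union> Poly_Mapping.keys q) - {s}"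
  using assms by (auto simp: in_keys_iff lookup_minus)

text \<open>The exponents of the monomial ideal generated by \<open>A\<close>; it turns statements
  about ideals of lead terms into combinatorics.\<close>

definition monomial_multiples :: "'v set \<Rightarrow> ('v \<Rightarrow>\<^sub>0 nat) set \<Rightarrow> ('v \<Rightarrow>\<^sub>0 nat) set" where
  "monomial_multiples V A = {s + u | s u. s \<in> A \<and> u \<in> monomials V}"

lemma monomial_multiplesI: "s \<in> A \<Longrightarrow> u \<in> monomials V \<Longrightarrow> s + u \<in> monomial_multiples V A"
  by (auto simp: monomial_multiples_def)

lemma monomial_multiples_superset: "A \<subseteq> monomial_multiples V A"
  using monomial_multiplesI[of _ A 0 V] by auto

locale mpolys_monomial_order = mpolys_over_subfield K V
  for K :: "'r::field set" and V :: "'v set" +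
  fixes r :: "('v \<Rightarrow>\<^sub>0 nat) rel"
  assumes fin: "finite V" and order: "monomial_order V r"
begin

abbreviation "lm \<equiv> lead_monomial r"
abbreviation "lc \<equiv> lead_coefficient r"

lemma well_order: "well_order_on (monomials V) r"
  using order by (simp add: monomial_order_def)

lemma wf_order: "wf (r - Id)"
  using well_order by (simp add: well_order_on_def)

lemma order_refl: "s \<in> monomials V \<Longrightarrow> (s, s) \<in> r"
  using well_order by (auto simp: order_on_defs refl_on_def)

lemma order_antisym: "(s, t) \<in> r \<Longrightarrow> (t, s) \<in> r \<Longrightarrow> s = t"
  using well_order by (auto simp: order_on_defs antisym_def)

lemma order_trans: "(s, t) \<in> r \<Longrightarrow> (t, u) \<in> r \<Longrightarrow> (s, u) \<in> r"
  using well_order by (auto simp: order_on_defs trans_def)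

lemma order_total: "s \<in> monomials V \<Longrightarrow> t \<in> monomials V \<Longrightarrow> (s, t) \<in> r \<or> (t, s) \<in> r"
  using well_order order_refl by (cases "s = t") (auto simp: order_on_defs total_on_def)

lemma order_add: "(s, t) \<in> r \<Longrightarrow> u \<in> monomials V \<Longrightarrow> (s + u, t + u) \<in> r"
  using order by (auto simp: monomial_order_def)

text \<open>If \<open>z\<close> is the least monomial, adding \<open>z\<close> to
  \<open>z \<le> 0\<close> gives \<open>z + z \<le> z\<close>; minimality gives the converse, so
  \<open>z = 0\<close>.\<close>

lemma order_0: "u \<in> monomials V \<Longrightarrow> (0, u) \<in> r"
proof -
  assume u: "u \<in> monomials V"
  obtain z where z: "z \<in> monomials V" "\<And>t. (t, z) \<in> r - Id \<Longrightarrow> t \<notin> monomials V"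
    using wfE_min[OF wf_order monomials_0] by metis
  have least: "(z, t) \<in> r" if "t \<in> monomials V" for t
    using order_total[OF z(1) that] z(2)[of t] that order_refl by auto
  have "(z + z, z) \<in> r"
    using order_add[OF least[OF monomials_0] z(1)] by simp
  then have "z + z = z"
    using least[of "z + z"] z(1) by (intro order_antisym) (auto simp: monomials_add_iff)
  then have "z = 0"
    by simp
  then show ?thesis
    using least[OF u] by simp
qed

lemma order_multiple: "s \<in> monomials V \<Longrightarrow> u \<in> monomials V \<Longrightarrow> (s, s + u) \<in> r"
  using order_add[OF order_0, of u s] by (simp add: add.commute)

lemma lm_eqI:
  assumes "s \<in> Poly_Mapping.keys p" and "\<And>t. t \<in> Poly_Mapping.keys p \<Longrightarrow> (t, s) \<in> r"
  shows "lm p = s"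
  unfolding lead_monomial_def using assms order_antisym by (intro the_equality) blast+

lemma finite_monomials_has_max:
  "finite A \<Longrightarrow> A \<noteq> {} \<Longrightarrow> A \<subseteq> monomials V \<Longrightarrow> \<exists>s\<in>A. \<forall>t\<in>A. (t, s) \<in> r"
proof (induction A rule: finite_ne_induct)
  case (singleton s)
  then show ?case using order_refl by auto
next
  case (insert s A)
  then obtain m where m: "m \<in> A" "\<forall>t\<in>A. (t, m) \<in> r"
    by auto
  have mon: "s \<in> monomials V" "m \<in> monomials V"
    using insert.prems m(1) by auto
  show ?case
  proof (cases "(s, m) \<in> r")
    case True
    then show ?thesis using m by auto
  next
    case False
    then have "(m, s) \<in> r"
      using order_total[OF mon] by blast
    then show ?thesis
      using m(2) order_refl[OF mon(1)] order_trans by blast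
  qed
qed

lemma lm_in_keys: "p \<in> carrier R \<Longrightarrow> p \<noteq> 0 \<Longrightarrow> lm p \<in> Poly_Mapping.keys p"
  and lm_max: "p \<in> carrier R \<Longrightarrow> t \<in> Poly_Mapping.keys p \<Longrightarrow> (t, lm p) \<in> r"
proof -
  have *: "\<exists>s\<in>Poly_Mapping.keys p. \<forall>t\<in>Poly_Mapping.keys p. (t, s) \<in> r" if "p \<in> carrier R" "p \<noteq> 0"
    using that by (intro finite_monomials_has_max) auto
  show "lm p \<in> Poly_Mapping.keys p" if "p \<in> carrier R" "p \<noteq> 0"
    using *[OF that] lm_eqI[of _ p] by metis
  show "(t, lm p) \<in> r" if "p \<in> carrier R" "t \<in> Poly_Mapping.keys p"
    using *[OF that(1)] lm_eqI[of _ p] that(2) by (metis keys_zero empty_iff)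
qed

lemma lm_in_monomials: "p \<in> carrier R \<Longrightarrow> p \<noteq> 0 \<Longrightarrow> lm p \<in> monomials V"
  using lm_in_keys keys_in by blast

lemma lc_nonzero: "p \<in> carrier R \<Longrightarrow> p \<noteq> 0 \<Longrightarrow> lc p \<noteq> 0"
  using lm_in_keys by (simp add: lead_coefficient_def in_keys_iff)

lemma lm_shift:
  assumes p: "p \<in> carrier R" "p \<noteq> 0" and u: "u \<in> monomials V"
  shows "Poly_Mapping.single u 1 * p \<noteq> 0" "lm (Poly_Mapping.single u 1 * p) = lm p + u"
proof -
  let ?q = "Poly_Mapping.single u 1 * p"
  have q: "?q = (\<Sum>s\<in>Poly_Mapping.keys p. Poly_Mapping.single (s + u) (Poly_Mapping.lookup p s))"
  proof -
    have "Poly_Mapping.single u 1 *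
        (\<Sum>s\<in>Poly_Mapping.keys p. Poly_Mapping.single s (Poly_Mapping.lookup p s)) =
      (\<Sum>s\<in>Poly_Mapping.keys p. Poly_Mapping.single (s + u) (Poly_Mapping.lookup p s))"
      by (simp add: sum_distrib_left mult_single add.commute)
    then show ?thesis
      by (simp flip: poly_mapping_sum_single)
  qed
  have lookup: "Poly_Mapping.lookup ?q (t + u) = Poly_Mapping.lookup p t" for t
    unfolding q
    by (auto simp: lookup_sum lookup_single when_def in_keys_iff if_distrib sum.delta cong: if_cong)
  have lm: "lm p + u \<in> Poly_Mapping.keys ?q"
    using lm_in_keys[OF p] lookup[of "lm p"] by (simp add: in_keys_iff)
  then show "?q \<noteq> 0"
    by auto
  show "lm ?q = lm p + u"
  proof (rule lm_eqI[OF lm])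
    fix t assume "t \<in> Poly_Mapping.keys ?q"
    then obtain s where "t = u + s" "s \<in> Poly_Mapping.keys p"
      using keys_mult[of "Poly_Mapping.single u 1" p] by (auto split: if_splits)
    then show "(t, lm p + u) \<in> r"
      using order_add[OF lm_max[OF p(1)] u] by (simp add: add.commute)
  qed
qed

text \<open>A polynomial lies in an ideal generated by terms as soon as each of its terms does, and
  over a field the coefficients of the generators are irrelevant.\<close>

lemma genideal_terms:
  assumes A: "A \<subseteq> monomials V" and c: "\<And>s. s \<in> A \<Longrightarrow> \<exists>c\<in>K. c \<noteq> 0 \<and> Poly_Mapping.single s c \<in> S"
    and S: "\<And>p. p \<in> S \<Longrightarrow> \<exists>s\<in>A. \<exists>c\<in>K. p = Poly_Mapping.single s c"
  shows "genideal R S = {p \<in> carrier R. Poly_Mapping.keys p \<subseteq> monomial_multiples V A}"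
proof
  let ?J = "{p \<in> carrier R. Poly_Mapping.keys p \<subseteq> monomial_multiples V A}"
  have S_carrier: "S \<subseteq> carrier R"
  proof
    fix p assume "p \<in> S"
    then obtain s c where "s \<in> A" "c \<in> K" "p = Poly_Mapping.single s c"
      using S by blast
    then show "p \<in> carrier R"
      using A by (auto intro: single_in)
  qed
  have "ideal ?J R"
    unfolding ideal_iff
  proof (intro conjI ballI)
    show "p + q \<in> ?J" if "p \<in> ?J" "q \<in> ?J" for p q
      using that keys_add[of p q] by auto
    show "p * q \<in> ?J" if pq: "p \<in> carrier R" "q \<in> ?J" for p q
    proof -
      have "s + t \<in> monomial_multiples V A" if st: "s \<in> Poly_Mapping.keys p" "t \<in> Poly_Mapping.keys q" for s t
      proof -
        obtain a u where "t = a + u" "a \<in> A" "u \<in> monomials V"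
          using pq(2) st(2) by (auto simp: monomial_multiples_def)
        moreover have "s \<in> monomials V"
          using pq(1) st(1) by blast
        ultimately show ?thesis
          using monomial_multiplesI[of a A "u + s" V] by (simp add: monomials_add_iff ac_simps)
      qed
      then show ?thesis
        using pq keys_mult[of p q] by auto
    qed
  qed auto
  moreover have "S \<subseteq> ?J"
  proof
    fix p assume p: "p \<in> S"
    then obtain s c where "s \<in> A" "c \<in> K" "p = Poly_Mapping.single s c"
      using S by blast
    then show "p \<in> ?J"
      using monomial_multiples_superset[of A V] S_carrier p by auto
  qed
  ultimately show "genideal R S \<subseteq> ?J"
    by (rule genideal_least)
  show "?J \<subseteq> genideal R S"
  proof
    fix p assume p: "p \<in> ?J"
    note I = ideal_genideal[OF S_carrier]
    have "Poly_Mapping.single t (Poly_Mapping.lookup p t) \<in> genideal R S" if t: "t \<in> Poly_Mapping.keys p" for t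
    proof -
      obtain s u where su: "t = s + u" "s \<in> A" "u \<in> monomials V"
        using p t by (auto simp: monomial_multiples_def)
      obtain c where c: "c \<in> K" "c \<noteq> 0" "Poly_Mapping.single s c \<in> S"
        using assms(2)[OF su(2)] by blast
      \<comment> \<open>This multiplier turns the generator with coefficient \<open>c\<close> into
        exactly the term of \<open>p\<close> at \<open>t\<close>.\<close>
      have "Poly_Mapping.lookup p t * inverse c \<in> K"
        using p c by auto
      then have "Poly_Mapping.single u (Poly_Mapping.lookup p t * inverse c) * Poly_Mapping.single s c
          \<in> genideal R S"
        using su c genideal_superset[of S] by (intro ideal_mult[OF I] single_in) auto
      then show ?thesis
        using c(2) by (simp add: mult_single su(1) add.commute mult.assoc)
    qed
    then have "(\<Sum>t\<in>Poly_Mapping.keys p. Poly_Mapping.single t (Poly_Mapping.lookup p t)) \<in> genideal R S"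
      by (intro ideal_sum[OF I])
    then show "p \<in> genideal R S"
      by (simp flip: poly_mapping_sum_single)
  qed
qed

lemma genideal_lead_terms:
  assumes "G \<subseteq> carrier R" and "0 \<notin> G"
  shows "genideal R (lead_term r ` G) = {p \<in> carrier R. Poly_Mapping.keys p \<subseteq> monomial_multiples V (lm ` G)}"
proof (rule genideal_terms)
  have G: "g \<in> carrier R" "g \<noteq> 0" if "g \<in> G" for g
    using assms that by auto
  show "lm ` G \<subseteq> monomials V"
    using G lm_in_monomials by blast
  show "\<exists>c\<in>K. c \<noteq> 0 \<and> Poly_Mapping.single s c \<in> lead_term r ` G" if "s \<in> lm ` G" for s
    using that G lc_nonzero by (force simp: lead_term_def lead_coefficient_def)
  show "\<exists>s\<in>lm ` G. \<exists>c\<in>K. p = Poly_Mapping.single s c" if "p \<in> lead_term r ` G" for p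
    using that G by (force simp: lead_term_def lead_coefficient_def)
qed

lemma single_in_genideal_lead_terms_iff:
  assumes "G \<subseteq> carrier R" and "0 \<notin> G" and "s \<in> monomials V"
  shows "Poly_Mapping.single s 1 \<in> genideal R (lead_term r ` G) \<longleftrightarrow> s \<in> monomial_multiples V (lm ` G)"
  using assms by (simp add: genideal_lead_terms single_in)

text \<open>A monomial ideal is determined by the monomials it contains, so the Groebner condition
  becomes an equality of exponent sets.\<close>

lemma genideal_lead_terms_eq_iff:
  assumes "G \<subseteq> carrier R" "0 \<notin> G" "G' \<subseteq> carrier R" "0 \<notin> G'"
  shows "genideal R (lead_term r ` G) = genideal R (lead_term r ` G') \<longleftrightarrow>
    monomial_multiples V (lm ` G) = monomial_multiples V (lm ` G')"
proof
  have sub: "monomial_multiples V (lm ` H) \<subseteq> monomials V" if "H \<subseteq> carrier R" "0 \<notin> H" for H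
  proof -
    have "lm h \<in> monomials V" if "h \<in> H" for h
      using lm_in_monomials[of h] that \<open>H \<subseteq> carrier R\<close> \<open>0 \<notin> H\<close> by (metis subsetD)
    then show ?thesis
      by (auto simp: monomial_multiples_def monomials_add_iff)
  qed
  assume "genideal R (lead_term r ` G) = genideal R (lead_term r ` G')"
  then have "s \<in> monomial_multiples V (lm ` G) \<longleftrightarrow> s \<in> monomial_multiples V (lm ` G')"
    if "s \<in> monomials V" for s
    using single_in_genideal_lead_terms_iff[OF assms(1,2) that]
      single_in_genideal_lead_terms_iff[OF assms(3,4) that] by simp
  then show "monomial_multiples V (lm ` G) = monomial_multiples V (lm ` G')"
    using sub[OF assms(1,2)] sub[OF assms(3,4)] by blast
qed (simp add: genideal_lead_terms assms)

subsection \<open>Existence and uniqueness\<close>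

context
  fixes I assumes I: "ideal I R"
begin

definition lead_monomials :: "('v \<Rightarrow>\<^sub>0 nat) set" where
  "lead_monomials = lm ` (I - {0})"

text \<open>Minimality is with respect to divisibility, not to \<open>r\<close>. These turn out to
  be the lead monomials of the reduced basis.\<close>

definition minimal_lead_monomials :: "('v \<Rightarrow>\<^sub>0 nat) set" where
  "minimal_lead_monomials = {s \<in> lead_monomials. \<forall>t u. t \<in> lead_monomials \<longrightarrow> s = t + u \<longrightarrow> u = 0}"

lemma lead_monomials_subset: "lead_monomials \<subseteq> monomials V"
  using ideal_subset[OF I] lm_in_monomials by (auto simp: lead_monomials_def)

lemma multiples_lead_monomials: "monomial_multiples V lead_monomials = lead_monomials"
proof
  show "monomial_multiples V lead_monomials \<subseteq> lead_monomials"
  proof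
    fix t assume "t \<in> monomial_multiples V lead_monomials"
    then obtain p u where p: "t = lm p + u" "p \<in> I" "p \<noteq> 0" "u \<in> monomials V"
      by (auto simp: monomial_multiples_def lead_monomials_def)
    have "Poly_Mapping.single u 1 * p \<in> I"
      using p by (intro ideal_mult[OF I] single_in) auto
    then show "t \<in> lead_monomials"
      using lm_shift[of p u] p ideal_subset[OF I] unfolding lead_monomials_def
      by (intro image_eqI[of _ _ "Poly_Mapping.single u 1 * p"]) auto
  qed
qed (rule monomial_multiples_superset)

text \<open>A nonzero element of \<open>I\<close> carries its own lead monomial. Applied to
  differences, this is the uniqueness of normal forms.\<close>

lemma eq_zero_if_keys_not_lead:
  assumes "p \<in> I" and "Poly_Mapping.keys p \<inter> lead_monomials = {}"
  shows "p = 0"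
  using assms lm_in_keys[of p] ideal_subset[OF I] by (auto simp: lead_monomials_def)

text \<open>The order \<open>r\<close> extends divisibility, so the \<open>r\<close>-least lead
  monomial dividing \<open>s\<close> is minimal for divisibility, and well-foundedness provides
  it.\<close>

lemma minimal_lead_monomial_dvd:
  assumes "s \<in> lead_monomials"
  shows "\<exists>b\<in>minimal_lead_monomials. \<exists>u\<in>monomials V. s = b + u"
proof -
  define A where "A = {t \<in> lead_monomials. \<exists>u. s = t + u}"
  have "s \<in> A"
    using assms by (auto simp: A_def intro: exI[of _ 0])
  then obtain b where b: "b \<in> A" "\<And>t. (t, b) \<in> r - Id \<Longrightarrow> t \<notin> A"
    using wfE_min[OF wf_order, of s A] by metis
  then obtain u where u: "s = b + u"
    by (auto simp: A_def)
  have mon: "b \<in> monomials V" "u \<in> monomials V"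
    using u assms lead_monomials_subset monomials_add_iff[of b u V] by auto
  have "w = 0" if tw: "t \<in> lead_monomials" "b = t + w" for t w
  proof (rule ccontr)
    assume "w \<noteq> 0"
    have "t \<in> monomials V" "w \<in> monomials V"
      using mon(1) tw(2) by (auto simp: monomials_add_iff)
    then have "(t, b) \<in> r - Id"
      using order_multiple[of t w] tw(2) \<open>w \<noteq> 0\<close> by auto
    moreover have "t \<in> A"
      using tw u by (auto simp: A_def add.assoc)
    ultimately show False
      using b(2) by blast
  qed
  then have "b \<in> minimal_lead_monomials"
    using b(1) by (auto simp: A_def minimal_lead_monomials_def)
  then show ?thesis
    using u mon by blast
qed

lemma multiples_minimal_lead_monomials: "monomial_multiples V minimal_lead_monomials = lead_monomials"
proof
  show "monomial_multiples V minimal_lead_monomials \<subseteq> lead_monomials"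
    using multiples_lead_monomials by (auto simp: monomial_multiples_def minimal_lead_monomials_def)
  show "lead_monomials \<subseteq> monomial_multiples V minimal_lead_monomials"
    using minimal_lead_monomial_dvd unfolding monomial_multiples_def by blast
qed

lemma finite_minimal_lead_monomials: "finite minimal_lead_monomials"
proof (rule Dickson[OF fin])
  show "minimal_lead_monomials \<subseteq> monomials V"
    using lead_monomials_subset by (auto simp: minimal_lead_monomials_def)
qed (auto simp: minimal_lead_monomials_def)

text \<open>Division with remainder by well-founded induction, using all of \<open>I\<close> instead
  of a basis. The bound by \<open>s\<close> is kept so that subtracting the normal form does not
  change the lead monomial.\<close>

lemma monomial_normal_form:
  assumes "s \<in> monomials V"
  shows "\<exists>g\<in>carrier R. Poly_Mapping.single s 1 - g \<in> I \<and> Poly_Mapping.keys g \<inter> lead_monomials = {} \<and>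
    (\<forall>t\<in>Poly_Mapping.keys g. (t, s) \<in> r)"
  using assms
proof (induction s rule: wf_induct_rule[OF wf_order])
  case (1 s)
  show ?case
  proof (cases "s \<in> lead_monomials")
    case False
    then show ?thesis
      using 1(2) order_refl ideal_zero[OF I]
      by (intro bexI[of _ "Poly_Mapping.single s 1"]) (auto intro: single_in)
  next
    case True
    then obtain p where p: "p \<in> I" "p \<noteq> 0" "lm p = s"
      by (auto simp: lead_monomials_def)
    have pR: "p \<in> carrier R"
      using ideal_subset[OF I p(1)] .
    define c where "c = inverse (lc p)"
    have c: "c \<in> K" "c * lc p = 1"
      using lc_nonzero[OF pR p(2)] pR by (auto simp: c_def lead_coefficient_def)
    define p' where "p' = Poly_Mapping.single 0 c * p"
    have p': "p' \<in> I"
      unfolding p'_def using c(1) p(1) by (intro ideal_mult[OF I] single_in) auto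
    have lookup_p': "Poly_Mapping.lookup p' t = c * Poly_Mapping.lookup p t" for t
      unfolding p'_def mult_map_scale_conv_mult[symmetric] by (simp add: Poly_Mapping.map.rep_eq when_def)
    \<comment> \<open>The multiple \<open>p'\<close> is monic with lead monomial \<open>s\<close>,
      so \<open>q\<close> is congruent to the monomial \<open>s\<close> and lies strictly below it;
      its monomials have normal forms by induction.\<close>
    define q where "q = Poly_Mapping.single s 1 - p'"
    have q: "q \<in> carrier R"
      unfolding q_def using 1(2) ideal_subset[OF I p'] by (intro diff_in single_in) auto
    have q_keys: "(t, s) \<in> r - Id" if t: "t \<in> Poly_Mapping.keys q" for t
    proof -
      have "Poly_Mapping.lookup q s = 0"
        using c(2) p(3) by (simp add: q_def lookup_minus lookup_p' lead_coefficient_def)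
      then have "t \<noteq> s"
        using t by (auto simp: in_keys_iff)
      then have "t \<in> Poly_Mapping.keys p"
        using t by (auto simp: in_keys_iff q_def lookup_minus lookup_p' lookup_single when_def)
      then show ?thesis
        using lm_max[OF pR] p(3) \<open>t \<noteq> s\<close> by auto
    qed
    have "\<forall>t\<in>Poly_Mapping.keys q. \<exists>g\<in>carrier R. Poly_Mapping.single t 1 - g \<in> I \<and>
        Poly_Mapping.keys g \<inter> lead_monomials = {} \<and> (\<forall>w\<in>Poly_Mapping.keys g. (w, t) \<in> r)"
      using 1(1) q_keys q by blast
    then obtain g where g: "\<And>t. t \<in> Poly_Mapping.keys q \<Longrightarrow> g t \<in> carrier R"
      "\<And>t. t \<in> Poly_Mapping.keys q \<Longrightarrow> Poly_Mapping.single t 1 - g t \<in> I"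
      "\<And>t. t \<in> Poly_Mapping.keys q \<Longrightarrow> Poly_Mapping.keys (g t) \<inter> lead_monomials = {}"
      "\<And>t w. t \<in> Poly_Mapping.keys q \<Longrightarrow> w \<in> Poly_Mapping.keys (g t) \<Longrightarrow> (w, t) \<in> r"
      by metis
    let ?c = "\<lambda>t. Poly_Mapping.single 0 (Poly_Mapping.lookup q t)"
    define h where "h = (\<Sum>t\<in>Poly_Mapping.keys q. ?c t * g t)"
    have c_in: "?c t \<in> carrier R" for t
      using q by (auto intro: single_in)
    have "h \<in> carrier R"
      unfolding h_def using g(1) c_in by (intro sum_in) auto
    moreover have "Poly_Mapping.single s 1 - h \<in> I"
    proof -
      have "q = (\<Sum>t\<in>Poly_Mapping.keys q. ?c t * Poly_Mapping.single t 1)"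
        using poly_mapping_sum_single[of q] by (simp add: mult_single)
      then have "q - h = (\<Sum>t\<in>Poly_Mapping.keys q. ?c t * (Poly_Mapping.single t 1 - g t))"
        by (simp add: h_def right_diff_distrib sum_subtractf)
      also have "\<dots> \<in> I"
        using g(2) c_in by (intro ideal_sum[OF I] ideal_mult[OF I]) auto
      finally have "p' + (q - h) \<in> I"
        using p' ideal_add[OF I] by blast
      then show ?thesis
        by (simp add: q_def)
    qed
    moreover have "\<exists>t\<in>Poly_Mapping.keys q. w \<in> Poly_Mapping.keys (g t)" if w: "w \<in> Poly_Mapping.keys h" for w
    proof -
      obtain t where t: "t \<in> Poly_Mapping.keys q" "w \<in> Poly_Mapping.keys (?c t * g t)"
        using w keys_sum[of "\<lambda>t. ?c t * g t" "Poly_Mapping.keys q"] unfolding h_def by blast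
      then show ?thesis
        using keys_mult[of "?c t" "g t"] by (auto split: if_splits)
    qed
    then have "Poly_Mapping.keys h \<inter> lead_monomials = {}" "\<forall>w\<in>Poly_Mapping.keys h. (w, s) \<in> r"
      using g(3,4) q_keys order_trans by blast+
    ultimately show ?thesis
      by blast
  qed
qed

text \<open>All ideal conditions become conditions on exponents; \<open>0 \<notin> G\<close> is free
  because the zero polynomial has lead coefficient 0, not 1.\<close>

lemma is_reduced_groebner_basis_iff:
  "is_reduced_groebner_basis K V r I G \<longleftrightarrow> finite G \<and> G \<subseteq> I \<and> 0 \<notin> G \<and>
     monomial_multiples V (lm ` G) = lead_monomials \<and>
     (\<forall>p\<in>G. lc p = 1 \<and> Poly_Mapping.keys p \<inter> monomial_multiples V (lm ` (G - {p})) = {})"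
proof -
  have zero: "0 \<notin> G" if "\<forall>p\<in>G. lc p = 1"
    using that by (auto simp: lead_coefficient_def)
  have I_sub: "I - {0} \<subseteq> carrier R" "0 \<notin> I - {0}"
    using ideal_subset[OF I] by auto
  have basis: "genideal R (lead_term r ` (G - {0})) = genideal R (lead_term r ` (I - {0})) \<longleftrightarrow>
      monomial_multiples V (lm ` G) = lead_monomials" if "G \<subseteq> I" "0 \<notin> G"
    using genideal_lead_terms_eq_iff[OF _ _ I_sub, of G] that ideal_subset[OF I]
    by (simp add: subset_iff lead_monomials_def[symmetric] multiples_lead_monomials)
  have red: "Poly_Mapping.single s 1 \<notin> genideal R (lead_term r ` (G - {p})) \<longleftrightarrow>
      s \<notin> monomial_multiples V (lm ` (G - {p}))"
    if "G \<subseteq> I" "0 \<notin> G" "p \<in> G" "s \<in> Poly_Mapping.keys p" for p s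
  proof -
    have "s \<in> monomials V" "G - {p} \<subseteq> carrier R"
      using that ideal_subset[OF I] by blast+
    then show ?thesis
      using single_in_genideal_lead_terms_iff[of "G - {p}" s] that(2) by simp
  qed
  show ?thesis
    unfolding is_reduced_groebner_basis_def groebner_basis_def
    using zero basis red by (auto simp: disjoint_iff)
qed

text \<open>Such a \<open>t\<close> is a multiple of some \<open>lm g\<close>, and reducedness
  leaves only \<open>g = p\<close>. Then \<open>t\<close> is both at least and at most
  \<open>lm p\<close>.\<close>

lemma reduced_basis_keys:
  assumes G: "is_reduced_groebner_basis K V r I G" and p: "p \<in> G" and t: "t \<in> Poly_Mapping.keys p" "t \<in> lead_monomials"
  shows "t = lm p"
proof -
  note G = G[unfolded is_reduced_groebner_basis_iff]
  obtain g u where g: "g \<in> G" "u \<in> monomials V" "t = lm g + u"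
    using G t(2) unfolding monomial_multiples_def by blast
  have "t \<notin> monomial_multiples V (lm ` (G - {p}))"
    using G p t(1) by blast
  then have "g = p"
    using g monomial_multiplesI[of "lm g" "lm ` (G - {p})" u V] by auto
  moreover have pR: "p \<in> carrier R" "p \<noteq> 0"
    using G p ideal_subset[OF I] by blast+
  ultimately show ?thesis
    using lm_max[OF pR(1) t(1)] order_multiple[OF lm_in_monomials[OF pR] g(2)] g(3)
    by (metis order_antisym)
qed

text \<open>A minimal lead monomial is a multiple of some \<open>lm g\<close>, hence equal to it.
  Conversely, a minimal divisor of \<open>lm g\<close> is the lead monomial of some member, which
  reducedness identifies with \<open>g\<close>.\<close>

lemma reduced_basis_lm_image:
  assumes G: "is_reduced_groebner_basis K V r I G"
  shows "lm ` G = minimal_lead_monomials"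
proof -
  note G' = G[unfolded is_reduced_groebner_basis_iff]
  have lm_lead: "lm g \<in> lead_monomials" if "g \<in> G" for g
    using G' that by (auto simp: lead_monomials_def)
  have B: "b \<in> lm ` G" if b: "b \<in> minimal_lead_monomials" for b
  proof -
    have "b \<in> monomial_multiples V (lm ` G)"
      using b G' by (auto simp: minimal_lead_monomials_def)
    then obtain g u where g: "g \<in> G" "b = lm g + u"
      by (auto simp: monomial_multiples_def)
    then show ?thesis
      using b lm_lead[of g] by (auto simp: minimal_lead_monomials_def)
  qed
  have "lm g \<in> minimal_lead_monomials" if g: "g \<in> G" for g
  proof -
    obtain b u where b: "b \<in> minimal_lead_monomials" "u \<in> monomials V" "lm g = b + u"
      using minimal_lead_monomial_dvd[OF lm_lead[OF g]] by blast
    obtain g' where g': "g' \<in> G" "b = lm g'"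
      using B[OF b(1)] by blast
    have "lm g \<in> Poly_Mapping.keys g"
      using g G' ideal_subset[OF I] by (intro lm_in_keys) auto
    then have "lm g \<notin> monomial_multiples V (lm ` (G - {g}))"
      using g G' by blast
    then have "g' = g"
      using monomial_multiplesI[of "lm g'" "lm ` (G - {g})" u V] g' b by auto
    then show ?thesis
      using b(1) g' by simp
  qed
  then show ?thesis
    using B by blast
qed

text \<open>Members with the same lead monomial are both monic there and contain no other lead
  monomial, so their difference vanishes.\<close>

lemma reduced_groebner_basis_unique:
  assumes G: "is_reduced_groebner_basis K V r I G" and H: "is_reduced_groebner_basis K V r I H"
  shows "G = H"
proof -
  have "G \<subseteq> H" if G: "is_reduced_groebner_basis K V r I G" and H: "is_reduced_groebner_basis K V r I H" for G H
  proof
    note G' = G[unfolded is_reduced_groebner_basis_iff] and H' = H[unfolded is_reduced_groebner_basis_iff]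
    fix g assume g: "g \<in> G"
    then obtain h where h: "h \<in> H" "lm g = lm h"
      using reduced_basis_lm_image[OF G] reduced_basis_lm_image[OF H] by (metis imageE imageI)
    have "Poly_Mapping.lookup g (lm g) = Poly_Mapping.lookup h (lm g)"
      using G' H' g h by (metis lead_coefficient_def)
    then have "Poly_Mapping.keys (g - h) \<inter> lead_monomials = {}"
      using keys_diff_subset[of g "lm g" h] reduced_basis_keys[OF G g] reduced_basis_keys[OF H h(1)] h(2) by auto
    moreover have "g - h \<in> I"
      using G' H' g h by (intro ideal_diff[OF I]) auto
    ultimately have "g - h = 0"
      by (rule eq_zero_if_keys_not_lead[rotated])
    then show "g \<in> H"
      using h by simp
  qed
  then show ?thesis
    using G H by blast
qed

text \<open>The basis consists of the minimal lead monomials minus their normal forms.\<close>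

lemma reduced_groebner_basis_exists: "\<exists>G. is_reduced_groebner_basis K V r I G"
proof -
  have B_mon: "b \<in> monomials V" if "b \<in> minimal_lead_monomials" for b
    using that lead_monomials_subset by (auto simp: minimal_lead_monomials_def)
  obtain n where n: "\<And>b. b \<in> minimal_lead_monomials \<Longrightarrow> n b \<in> carrier R"
    "\<And>b. b \<in> minimal_lead_monomials \<Longrightarrow> Poly_Mapping.single b 1 - n b \<in> I"
    "\<And>b. b \<in> minimal_lead_monomials \<Longrightarrow> Poly_Mapping.keys (n b) \<inter> lead_monomials = {}"
    "\<And>b t. b \<in> minimal_lead_monomials \<Longrightarrow> t \<in> Poly_Mapping.keys (n b) \<Longrightarrow> (t, b) \<in> r"
    using monomial_normal_form[OF B_mon] by metis
  define p where "p b = Poly_Mapping.single b 1 - n b" for b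
  have B: "b \<in> lead_monomials" if "b \<in> minimal_lead_monomials" for b
    using that by (simp add: minimal_lead_monomials_def)
  have lookup_p: "Poly_Mapping.lookup (p b) b = 1" if "b \<in> minimal_lead_monomials" for b
    using n(3)[OF that] B[OF that] by (auto simp: p_def lookup_minus in_keys_iff)
  have keys_p: "t = b \<or> t \<in> Poly_Mapping.keys (n b)" if "t \<in> Poly_Mapping.keys (p b)" for t b
    using that by (auto simp: p_def lookup_minus in_keys_iff lookup_single when_def split: if_splits)
  have lm_p: "lm (p b) = b" if b: "b \<in> minimal_lead_monomials" for b
  proof (rule lm_eqI)
    show "b \<in> Poly_Mapping.keys (p b)"
      using lookup_p[OF b] by (simp add: in_keys_iff)
    show "(t, b) \<in> r" if "t \<in> Poly_Mapping.keys (p b)" for t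
      using keys_p[OF that] n(4)[OF b] order_refl B_mon[OF b] by blast
  qed
  let ?G = "p ` minimal_lead_monomials"
  have lm_G: "lm ` ?G = minimal_lead_monomials"
    using lm_p by (force simp: image_image)
  have "is_reduced_groebner_basis K V r I ?G"
    unfolding is_reduced_groebner_basis_iff
  proof (intro conjI ballI)
    show "finite ?G"
      using finite_minimal_lead_monomials by simp
    show "?G \<subseteq> I"
      using n(2) by (auto simp: p_def)
    show "0 \<notin> ?G"
      using lookup_p by fastforce
    show "monomial_multiples V (lm ` ?G) = lead_monomials"
      unfolding lm_G by (rule multiples_minimal_lead_monomials)
  next
    fix g assume "g \<in> ?G"
    then obtain b where b: "b \<in> minimal_lead_monomials" "g = p b"
      by blast
    then show "lc g = 1"
      using lm_p lookup_p by (simp add: lead_coefficient_def)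
    have "t \<notin> monomial_multiples V (lm ` (?G - {g}))" if t: "t \<in> Poly_Mapping.keys g" for t
    proof
      assume "t \<in> monomial_multiples V (lm ` (?G - {g}))"
      then obtain b' u where b': "b' \<in> minimal_lead_monomials" "p b' \<noteq> g" "t = b' + u" "u \<in> monomials V"
        unfolding monomial_multiples_def using lm_p by force
      then have "t \<in> lead_monomials"
        using multiples_minimal_lead_monomials monomial_multiplesI by blast
      then have "t = b"
        using keys_p[of t b] t b n(3) by blast
      then have "u = 0"
        using b(1) b'(3) B[OF b'(1)] by (auto simp: minimal_lead_monomials_def)
      then show False
        using b b' \<open>t = b\<close> by simp
    qed
    then show "Poly_Mapping.keys g \<inter> monomial_multiples V (lm ` (?G - {g})) = {}"
      by blast
  qed
  then show ?thesis
    by blast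
qed

lemma is_reduced_groebner_basis_one:
  assumes "1 \<in> I"
  shows "is_reduced_groebner_basis K V r I {1}"
proof -
  have lm_1: "lm 1 = 0"
    by (rule lm_eqI) (auto simp: order_0)
  \<comment> \<open>The exponent 0 is the constant monomial, which divides everything.\<close>
  have "0 \<in> lead_monomials"
    unfolding lead_monomials_def using assms lm_1 by (intro image_eqI[of _ _ 1]) auto
  then have "monomials V \<subseteq> lead_monomials"
    using multiples_lead_monomials monomial_multiplesI[of 0 lead_monomials _ V] by auto
  then have "lead_monomials = monomials V"
    using lead_monomials_subset by blast
  then show ?thesis
    unfolding is_reduced_groebner_basis_iff using assms
    by (auto simp: lm_1 lead_coefficient_def monomial_multiples_def)
qed

theorem reduced_groebner_basis_eq_one_iff: "reduced_groebner_basis K V r I = {1} \<longleftrightarrow> 1 \<in> I"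
proof -
  obtain G where G: "is_reduced_groebner_basis K V r I G"
    using reduced_groebner_basis_exists by blast
  then have eq: "reduced_groebner_basis K V r I = G"
    unfolding reduced_groebner_basis_def using reduced_groebner_basis_unique by (intro the_equality)
  show ?thesis
  proof
    assume "reduced_groebner_basis K V r I = {1}"
    then show "1 \<in> I"
      using G eq unfolding is_reduced_groebner_basis_iff by auto
  next
    assume "1 \<in> I"
    then show "reduced_groebner_basis K V r I = {1}"
      using eq G is_reduced_groebner_basis_one reduced_groebner_basis_unique by blast
  qed
qed

end

end

section \<open>Lower triangular matrices\<close>

text \<open>The least moved point would be sent to a smaller, hence fixed, point, against
  injectivity.\<close>

lemma permutes_le_imp_id:
  fixes p :: "'n::{finite,linorder} \<Rightarrow> 'n"
  assumes p: "p permutes UNIV" and le: "\<And>i. p i \<le> i"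
  shows "p = id"
proof (rule ccontr)
  assume "p \<noteq> id"
  then have ne: "{i. p i \<noteq> i} \<noteq> {}"
    by (auto simp: fun_eq_iff)
  define m where "m = Min {i. p i \<noteq> i}"
  have "p m \<noteq> m"
    using Min_in[OF _ ne] by (simp add: m_def)
  then have "p m < m"
    using le[of m] by simp
  then have "p m \<notin> {i. p i \<noteq> i}"
    using Min_le[of "{i. p i \<noteq> i}" "p m"] unfolding m_def by (meson finite leD)
  then have "p (p m) = p m"
    by simp
  then show False
    using permutes_inj[OF p] \<open>p m \<noteq> m\<close> by (auto dest: injD)
qed

lemma det_lower_triangular:
  fixes A :: "('r::comm_ring_1, 'n::{finite,linorder}) sqmatrix"
  assumes "lower_triangular A"
  shows "det A = (\<Prod>i\<in>UNIV. A $ i $ i)"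
proof -
  let ?f = "\<lambda>p. of_int (sign p) * (\<Prod>i\<in>UNIV. A $ i $ p i)"
  have "?f p = 0" if p: "p permutes UNIV" "p \<noteq> id" for p
  proof -
    obtain i where "i < p i"
      using permutes_le_imp_id[OF p(1)] p(2) by (meson not_le)
    then have "A $ i $ p i = 0"
      using assms by (simp add: lower_triangular_def)
    then have "(\<Prod>i\<in>UNIV. A $ i $ p i) = 0"
      by (intro prod_zero) auto
    then show ?thesis
      by simp
  qed
  then have "det A = sum ?f {id}"
    unfolding det_def by (intro sum.mono_neutral_right) (auto simp: permutes_id)
  then show ?thesis
    by simp
qed

lemma invertible_lower_triangular_iff:
  fixes A :: "('r::field, 'n::{finite,linorder}) sqmatrix"
  assumes "lower_triangular A"
  shows "invertible A \<longleftrightarrow> (\<forall>i. A $ i $ i \<noteq> 0)"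
  using assms by (simp add: invertible_det_nz det_lower_triangular)

definition unitriangular :: "('r::zero_neq_one, 'n::{finite,linorder}) sqmatrix \<Rightarrow> bool" where
  "unitriangular A \<longleftrightarrow> lower_triangular A \<and> (\<forall>i. A $ i $ i = 1)"

lemma unitriangular_invertible: "unitriangular A \<Longrightarrow> invertible A"
  for A :: "('r::field, 'n::{finite,linorder}) sqmatrix"
  by (auto simp: unitriangular_def invertible_lower_triangular_iff)

text \<open>The unitriangular factor of \<open>A\<close> after its diagonal is split off on the
  left.\<close>

definition row_normalize :: "('r::field, 'n::finite) sqmatrix \<Rightarrow> ('r, 'n) sqmatrix" where
  "row_normalize A = (\<chi> i j. A $ i $ j / A $ i $ i)"

lemma unitriangular_row_normalize:
  "lower_triangular A \<Longrightarrow> invertible A \<Longrightarrow> unitriangular (row_normalize A)"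
  by (auto simp: unitriangular_def lower_triangular_def row_normalize_def
      invertible_lower_triangular_iff[unfolded lower_triangular_def])

lemma supp_row_normalize:
  fixes A :: "('r::field, 'a::finite) sqmatrix" and B :: "('r, 'b::finite) sqmatrix"
    and C :: "('r, 'c::finite) sqmatrix"
  assumes "\<And>i. A $ i $ i \<noteq> 0" "\<And>i. B $ i $ i \<noteq> 0" "\<And>i. C $ i $ i \<noteq> 0"
  shows "supp (tensor_act (row_normalize A) (row_normalize B) (row_normalize C) T) = supp (tensor_act A B C T)"
proof -
  have "tensor_act (row_normalize A) (row_normalize B) (row_normalize C) T $ i $ j $ k =
      tensor_act A B C T $ i $ j $ k / (A $ i $ i * B $ j $ j * C $ k $ k)" for i j k
    by (simp add: tensor_act_def row_normalize_def sum_divide_distrib)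
  then show ?thesis
    using assms by (simp add: supp_def)
qed

section \<open>The inequalities selected by the algorithm\<close>

text \<open>Finiteness serves Dickson's lemma and, by way of countability, the
  Nullstellensatz.\<close>

instance low_var :: (finite, finite, finite) finite
proof
  have "UNIV \<subseteq> (range (\<lambda>(i, j). XA i j) \<union> range (\<lambda>(i, j). XB i j) \<union> range (\<lambda>(i, j). XC i j)
    :: ('a, 'b, 'c) low_var set)"
  proof
    fix v :: "('a, 'b, 'c) low_var"
    show "v \<in> range (\<lambda>(i, j). XA i j) \<union> range (\<lambda>(i, j). XB i j) \<union> range (\<lambda>(i, j). XC i j)"
      by (cases v) force+
  qed
  then show "finite (UNIV :: ('a, 'b, 'c) low_var set)"
    by (rule finite_subset) simp
qed

text \<open>The specialization of \<open>generic_unitriangular\<close>; values of \<open>x\<close>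
  on and above the diagonal are ignored.\<close>

definition unitriangular_of :: "('n \<Rightarrow> 'n \<Rightarrow> 'r::zero_neq_one) \<Rightarrow> ('r, 'n::{finite,linorder}) sqmatrix" where
  "unitriangular_of x = (\<chi> i j. if j < i then x i j else if i = j then 1 else 0)"

lemma unitriangular_unitriangular_of: "unitriangular (unitriangular_of x)"
  by (auto simp: unitriangular_def lower_triangular_def unitriangular_of_def)

lemma unitriangular_of_entries: "unitriangular A \<Longrightarrow> unitriangular_of (\<lambda>i j. A $ i $ j) = A"
  by (auto simp: unitriangular_def lower_triangular_def unitriangular_of_def vec_eq_iff)

lemma eval_generic_unitriangular:
  "eval_mpoly x (generic_unitriangular f $ i $ j) = unitriangular_of (\<lambda>i j. x (f i j)) $ i $ j"
  by (simp add: generic_unitriangular_def unitriangular_of_def)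

lemma eval_generic_tensor:
  "eval_mpoly x (generic_tensor T $ i $ j $ k) =
    tensor_act (unitriangular_of (\<lambda>i j. x (XA i j))) (unitriangular_of (\<lambda>i j. x (XB i j)))
      (unitriangular_of (\<lambda>i j. x (XC i j))) T $ i $ j $ k"
  by (simp add: generic_tensor_def tensor_act_def eval_generic_unitriangular)

lemma subfield_entry_field: "subfield (entry_field T) ring_of_type_algebra"
  unfolding entry_field_def
  by (rule field.generate_field_is_subfield[OF field_from_type_algebra]) (simp add: ring_of_type_algebra_def)

lemma F_polys_subset:
  fixes T :: "(complex, 'a::{finite,linorder}, 'b::{finite,linorder}, 'c::{finite,linorder}) tensor"
  shows "F_polys T h \<subseteq> carrier (mpoly_ring (entry_field T) low_vars)"
proof -
  interpret mpolys_over_subfield "entry_field T" "low_vars :: ('a, 'b, 'c) low_var set"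
    by (intro mpolys_over_subfield.intro subfield_entry_field)
  have var: "var_poly v \<in> carrier R" if "v \<in> low_vars" for v :: "('a, 'b, 'c) low_var"
    unfolding var_poly_def using that by (intro single_in) (auto simp: monomials_def)
  have low: "i' < i \<Longrightarrow> XA i i' \<in> (low_vars :: ('a, 'b, 'c) low_var set)"
    "j' < j \<Longrightarrow> XB j j' \<in> (low_vars :: ('a, 'b, 'c) low_var set)"
    "k' < k \<Longrightarrow> XC k k' \<in> (low_vars :: ('a, 'b, 'c) low_var set)" for i i' j j' k k'
    by (auto simp: low_vars_def)
  have "generic_unitriangular XA $ i $ i' \<in> carrier R" for i i'
    by (auto simp: generic_unitriangular_def intro!: var low)
  moreover have "generic_unitriangular XB $ i $ i' \<in> carrier R" for i i'
    by (auto simp: generic_unitriangular_def intro!: var low)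
  moreover have "generic_unitriangular XC $ i $ i' \<in> carrier R" for i i'
    by (auto simp: generic_unitriangular_def intro!: var low)
  moreover have "const_poly (T $ i $ j $ k) \<in> carrier R" for i j k
    unfolding const_poly_def
    by (rule single_in) (auto simp: entry_field_def intro!: generate_field.incl)
  ultimately have "generic_tensor T $ i $ j $ k \<in> carrier R" for i j k
    by (simp add: generic_tensor_def tensor_act_def) (intro sum_in mult_in)
  then show ?thesis
    by (auto simp: F_polys_def)
qed

text \<open>The members of \<open>F_polys T h\<close> specialize to the entries at weights violating
  \<open>h\<close>.\<close>

lemma F_polys_vanish_iff:
  "(\<forall>p\<in>F_polys T h. eval_mpoly x p = 0) \<longleftrightarrow>
    supp (tensor_act (unitriangular_of (\<lambda>i j. x (XA i j))) (unitriangular_of (\<lambda>i j. x (XB i j)))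
      (unitriangular_of (\<lambda>i j. x (XC i j))) T) \<subseteq> halfspace h"
  unfolding F_polys_def supp_def Omega_in_def Omega_def eval_generic_tensor[symmetric] by blast

lemma one_in_F_ideal_iff:
  fixes T :: "(complex, 'a::{finite,linorder}, 'b::{finite,linorder}, 'c::{finite,linorder}) tensor"
  shows "1 \<in> F_ideal T h \<longleftrightarrow> (\<nexists>x. \<forall>p\<in>F_polys T h. eval_mpoly x p = 0)"
proof -
  interpret mpolys_over_subfield "entry_field T" "low_vars :: ('a, 'b, 'c) low_var set"
    by (intro mpolys_over_subfield.intro subfield_entry_field)
  have I: "ideal (F_ideal T h) R" "F_polys T h \<subseteq> F_ideal T h"
    unfolding F_ideal_def by (rule ideal_genideal[OF F_polys_subset], rule genideal_superset)
  have "\<exists>x. \<forall>p\<in>F_polys T h. eval_mpoly x p = 0" if "1 \<notin> F_ideal T h"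
    using weak_nullstellensatz_subfield[OF subfield_entry_field I(1) that] I(2) by blast
  moreover have "1 \<notin> F_ideal T h" if x: "\<forall>p\<in>F_polys T h. eval_mpoly x p = 0" for x
  proof -
    \<comment> \<open>The easy half: the polynomials vanishing at \<open>x\<close> form an ideal
      that omits 1.\<close>
    have "ideal {p \<in> carrier R. eval_mpoly x p = 0} R"
      unfolding ideal_iff by auto
    then have "F_ideal T h \<subseteq> {p \<in> carrier R. eval_mpoly x p = 0}"
      unfolding F_ideal_def using x F_polys_subset by (intro genideal_least) blast+
    then show ?thesis
      by auto
  qed
  ultimately show ?thesis
    by blast
qed

lemma selected_inequalities_eq:
  fixes T :: "(complex, 'a::{finite,linorder}, 'b::{finite,linorder}, 'c::{finite,linorder}) tensor"
  assumes "monomial_order low_vars r"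
  shows "selected_inequalities r H T = {h \<in> H. \<exists>A B C. unitriangular A \<and> unitriangular B \<and> unitriangular C \<and>
    supp (tensor_act A B C T) \<subseteq> halfspace h}"
proof -
  interpret mpolys_monomial_order "entry_field T" "low_vars :: ('a, 'b, 'c) low_var set" r
    by (intro mpolys_monomial_order.intro mpolys_over_subfield.intro mpolys_monomial_order_axioms.intro
        subfield_entry_field assms finite)
  have "reduced_groebner_basis (entry_field T) low_vars r (F_ideal T h) \<noteq> {1} \<longleftrightarrow>
      (\<exists>A B C. unitriangular A \<and> unitriangular B \<and> unitriangular C \<and> supp (tensor_act A B C T) \<subseteq> halfspace h)"
    (is "?L \<longleftrightarrow> ?R") for h
  proof -
    have "ideal (F_ideal T h) R"
      unfolding F_ideal_def by (rule ideal_genideal[OF F_polys_subset])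
    then have L: "?L \<longleftrightarrow> (\<exists>x. \<forall>p\<in>F_polys T h. eval_mpoly x p = 0)"
      by (simp add: reduced_groebner_basis_eq_one_iff one_in_F_ideal_iff)
    show ?thesis
    proof
      assume ?L
      then obtain x where "supp (tensor_act (unitriangular_of (\<lambda>i j. x (XA i j)))
          (unitriangular_of (\<lambda>i j. x (XB i j))) (unitriangular_of (\<lambda>i j. x (XC i j))) T) \<subseteq> halfspace h"
        using L F_polys_vanish_iff by blast
      then show ?R
        using unitriangular_unitriangular_of[of "\<lambda>i j. x (XA i j)"]
          unitriangular_unitriangular_of[of "\<lambda>i j. x (XB i j)"]
          unitriangular_unitriangular_of[of "\<lambda>i j. x (XC i j)"] by blast
    next
      assume ?R
      then obtain A B C where ABC: "unitriangular A" "unitriangular B" "unitriangular C"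
        "supp (tensor_act A B C T) \<subseteq> halfspace h"
        by blast
      \<comment> \<open>The point is read off from the matrices, which are recovered because they
        are unitriangular.\<close>
      define x where "x v = (case v of XA i j \<Rightarrow> A $ i $ j | XB i j \<Rightarrow> B $ i $ j | XC i j \<Rightarrow> C $ i $ j)" for v
      have "\<forall>p\<in>F_polys T h. eval_mpoly x p = 0"
        unfolding F_polys_vanish_iff using ABC by (simp add: x_def unitriangular_of_entries)
      then show ?L
        using L by blast
    qed
  qed
  then show ?thesis
    by (simp add: selected_inequalities_def)
qed

lemma convex_halfspace: "convex (halfspace h)"
  unfolding halfspace_def by (rule convex_halfspace_le)

theorem theorem3p5:
  fixes T :: "(complex, 'a::{finite,linorder}, 'b::{finite,linorder}, 'c::{finite,linorder}) tensor"
    and H :: "('a, 'b, 'c) weight_space inequality set"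
    and r :: "(('a, 'b, 'c) low_var \<Rightarrow>\<^sub>0 nat) rel"
  assumes "finite H" and "inequalities H"
    and "\<And>S. S \<subseteq> Omega \<Longrightarrow> \<exists>H'\<subseteq>H. defining_set H' (convex hull S)"
    and "monomial_order low_vars r"
  shows "borel_polytope T = (\<Inter>h\<in>selected_inequalities r H T. halfspace h) \<inter> dominant \<and>
    (\<forall>HD. finite HD \<and> inequalities HD \<and> defining_set HD dominant \<longrightarrow>
       defining_set (borel_algorithm r H HD T) (borel_polytope T))"
proof -
  note sel = selected_inequalities_eq[OF assms(4), of H T]
  have "(\<Inter>(A, B, C)\<in>GL_low. convex hull (supp (tensor_act A B C T))) =
    (\<Inter>h\<in>selected_inequalities r H T. halfspace h)"
  proof (intro equalityI subsetI)
    fix w assume w: "w \<in> (\<Inter>(A, B, C)\<in>GL_low. convex hull (supp (tensor_act A B C T)))"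
    show "w \<in> (\<Inter>h\<in>selected_inequalities r H T. halfspace h)"
    proof
      fix h assume "h \<in> selected_inequalities r H T"
      then obtain A B C where ABC: "unitriangular A" "unitriangular B" "unitriangular C"
        "supp (tensor_act A B C T) \<subseteq> halfspace h"
        unfolding sel by blast
      \<comment> \<open>One orbit member inside the half-space suffices, since its hull is among
        those being intersected.\<close>
      then have "(A, B, C) \<in> GL_low"
        by (auto simp: GL_low_def unitriangular_invertible) (auto simp: unitriangular_def)
      then have "w \<in> convex hull (supp (tensor_act A B C T))"
        using w by blast
      then show "w \<in> halfspace h"
        using hull_minimal[of _ "halfspace h" convex] ABC(4) convex_halfspace by blast
    qed
  next
    fix w assume w: "w \<in> (\<Inter>h\<in>selected_inequalities r H T. halfspace h)"
    have "w \<in> convex hull (supp (tensor_act A B C T))" if "(A, B, C) \<in> GL_low" for A B C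
    proof -
      have low: "lower_triangular A" "lower_triangular B" "lower_triangular C"
        and inv: "invertible A" "invertible B" "invertible C"
        using that by (auto simp: GL_low_def)
      let ?S = "supp (tensor_act A B C T)"
      have "?S \<subseteq> Omega"
        by (auto simp: supp_def Omega_def)
      \<comment> \<open>\<open>H'\<close> may vary with the triple. Each of its members holds on
        \<open>?S\<close> itself, and this is the reason it is selected.\<close>
      then obtain H' where H': "H' \<subseteq> H" "convex hull ?S = (\<Inter>h\<in>H'. halfspace h)"
        using assms(3)[of ?S] unfolding defining_set_def by blast
      \<comment> \<open>Selection speaks of unitriangular triples only, so the given triple is first
        normalized without changing the support.\<close>
      have S: "?S = supp (tensor_act (row_normalize A) (row_normalize B) (row_normalize C) T)"
        using low inv by (subst supp_row_normalize) (auto simp: invertible_lower_triangular_iff)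
      have "h \<in> selected_inequalities r H T" if h: "h \<in> H'" for h
      proof -
        have "?S \<subseteq> halfspace h"
          using hull_subset[of ?S convex] H'(2) h by blast
        then show ?thesis
          unfolding sel S using h H'(1) unitriangular_row_normalize[OF low(1) inv(1)]
            unitriangular_row_normalize[OF low(2) inv(2)] unitriangular_row_normalize[OF low(3) inv(3)]
          by blast
      qed
      then show ?thesis
        using w H'(2) by blast
    qed
    then show "w \<in> (\<Inter>(A, B, C)\<in>GL_low. convex hull (supp (tensor_act A B C T)))"
      by blast
  qed
  then have "borel_polytope T = (\<Inter>h\<in>selected_inequalities r H T. halfspace h) \<inter> dominant"
    unfolding borel_polytope_def by simp
  then show ?thesis
    by (simp add: defining_set_def borel_algorithm_def INT_Un)
qed

end
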